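(* Let $R$ be a f.a.s. semiring and let $(!,\mathsf{p},\mathsf{d},\mathsf{c},\mathsf{w},\overline{\mathsf{c}},\overline{\mathsf{w}})$ be an $R$-graded additive bialgebra modality on an additive symmetric monoidal category $\mathcal{L}$ with finite biproducts. Define the natural transformations $\chi^\otimes_r: !_r(A\oplus B) \to \bigoplus_{s+t=r} !_sA\otimes !_tB$ and $\chi^I: !_0\mathsf{0}\to I$ by $\chi^\otimes_r := \sum_{s+t=r} \mathsf{c}_{s,t};(!_s(\pi_0)\otimes !_t(\pi_1));\iota_{s,t}$ and $\chi^I := \mathsf{w}$. Then $\chi^\otimes_r$ and $\chi^I$ are natural isomorphisms with inverses ${\chi^\otimes_r}^{-1} := \sum_{s+t=r}\pi_{s,t};(!_s(\iota_0)\otimes !_t(\iota_1));\overline{\mathsf{c}}_{s,t}$ and ${\chi^I}^{-1} := \overline{\mathsf{w}}$. Thus $!_r(A\oplus B)\cong\bigoplus_{s+t=r} !_sA\otimes !_tB$ and $!_0\mathsf{0}\cong I$.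
   Context: Composition is diagrammatic ($f;g$ = first $f$ then $g$). An additive symmetric monoidal category is a strict symmetric monoidal category $(\mathcal{L},\otimes,I,\sigma)$ enriched over commutative monoids, with composition and $\otimes$ preserving sums and zeros. Finite biproducts are written $\oplus$ with projections $\pi_j$, injections $\iota_j$, and zero object $\mathsf{0}$; $\iota_{s,t}$, $\pi_{s,t}$ are the injection/projection of the $(s,t)$ summand, indexed over the finite set $\{(s,t): s+t=r\}$. A semiring $R$ is finite additive split (f.a.s.) if: for each $r$ the set of pairs $(s,t)$ with $s+t=r$ is finite; $s+t=0$ implies $s=t=0$, and $s+t=1$ implies $(s,t)\in\{(1,0),(0,1)\}$; and $R$ is additively cancellative. An $R$-graded coalgebra modality consists of endofunctors $!_r$ and natural transformations $\mathsf{p}_{r,s}: !_{rs}A\to !_r!_sA$, $\mathsf{c}_{r,s}: !_{r+s}A\to !_rA\otimes !_sA$, $\mathsf{d}: !_1A\to A$, $\mathsf{w}: !_0A\to I$ forming a graded comonad ($\mathsf{p},\mathsf{d}$), a graded cocommutative comonoid ($\mathsf{c},\mathsf{w}$), with $\mathsf{p}$ a graded comonoid morphism. An $R$-graded additive bialgebra modality adds natural transformations $\overline{\mathsf{c}}_{r,s}: !_rA\otimes !_sA\to !_{r+s}A$ and $\overline{\mathsf{w}}: I\to !_0A$ such that: $(\overline{\mathsf{c}},\overline{\mathsf{w}})$ is a graded commutative monoid (associative, unital, $\sigma;\overline{\mathsf{c}}_{s,r}=\overline{\mathsf{c}}_{r,s}$); the graded bimonoid laws $\overline{\mathsf{c}}_{r,s};\mathsf{c}_{t,u}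 = \sum_{a+b=r,\,c+d=s,\,a+c=t,\,b+d=u}(\mathsf{c}_{a,b}\otimes\mathsf{c}_{c,d});(1\otimes\sigma\otimes 1);(\overline{\mathsf{c}}_{a,c}\otimes\overline{\mathsf{c}}_{b,d})$ (for $r+s=t+u$), $\overline{\mathsf{w}};\mathsf{w}=1$, $\overline{\mathsf{w}};\mathsf{c}_{0,0}=\overline{\mathsf{w}}\otimes\overline{\mathsf{w}}$, $\overline{\mathsf{c}}_{0,0};\mathsf{w}=\mathsf{w}\otimes\mathsf{w}$ hold; $\overline{\mathsf{c}}_{r,s};\mathsf{d} = \delta_{r,0}\cdot(\mathsf{w}\otimes\mathsf{d}) + \delta_{0,s}\cdot(\mathsf{d}\otimes\mathsf{w})$ for $r+s=1$; and $!_r(f+g)=\sum_{s+t=r}\mathsf{c}_{s,t};(!_s(f)\otimes !_t(g));\overline{\mathsf{c}}_{s,t}$, with $!_r(0)=\mathsf{w};\overline{\mathsf{w}}$ if $r=0$ and $0$ otherwise. *)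

theory Defs
  imports "HOL-Algebra.FiniteProduct"
begin

section \<open>Finite additive split semirings\<close>

text \<open>
  Multiplication need not be commutative.  The base classes are used instead of
  \<^class>\<open>semiring_1\<close> because the latter demands \<open>0 \<noteq> 1\<close>, which would exclude the
  trivial semiring; that one is finite additive split, and grading by it is the ungraded case.
\<close>

class fas_semiring = semiring_0 + monoid_mult +
  assumes finite_splits: "finite {(s, t). s + t = r}"
    and split_zero: "s + t = 0 \<Longrightarrow> s = 0 \<and> t = 0"
    and split_one: "s + t = 1 \<Longrightarrow> (s, t) \<in> {(1, 0), (0, 1)}"
    and additively_cancellative: "r + s = r + t \<Longrightarrow> s = t"


section \<open>Categories, functors and natural transformations\<close>

text \<open>Composition is diagrammatic: \<open>f \<Zsemi> g\<close> is first \<open>f\<close>, then \<open>g\<close>.\<close>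

record ('o, 'm) category =
  Obj :: "'o set"
  Arr :: "'m set"
  Dom :: "'m \<Rightarrow> 'o"
  Cod :: "'m \<Rightarrow> 'o"
  Ide :: "'o \<Rightarrow> 'm"
  Comp :: "'m \<Rightarrow> 'm \<Rightarrow> 'm"  (infixl \<open>\<Zsemi>\<index>\<close> 60)

definition Hom :: "('o, 'm, 'z) category_scheme \<Rightarrow> 'o \<Rightarrow> 'o \<Rightarrow> 'm set" where
  "Hom C A B = {f \<in> Arr C. Dom C f = A \<and> Cod C f = B}"

locale category =
  fixes L :: "('o, 'm, 'z) category_scheme" (structure)
  assumes arr_obj: "f \<in> Arr L \<Longrightarrow> Dom L f \<in> Obj L \<and> Cod L f \<in> Obj L"
    and ide_hom: "A \<in> Obj L \<Longrightarrow> Ide L A \<in> Hom L A A"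
    and comp_hom: "f \<in> Hom L A B \<Longrightarrow> g \<in> Hom L B C \<Longrightarrow> f \<Zsemi> g \<in> Hom L A C"
    and comp_assoc: "f \<in> Hom L A B \<Longrightarrow> g \<in> Hom L B C \<Longrightarrow> h \<in> Hom L C D \<Longrightarrow>
      (f \<Zsemi> g) \<Zsemi> h = f \<Zsemi> (g \<Zsemi> h)"
    and ide_comp: "f \<in> Hom L A B \<Longrightarrow> Ide L A \<Zsemi> f = f"
    and comp_ide: "f \<in> Hom L A B \<Longrightarrow> f \<Zsemi> Ide L B = f"

definition inverse_arrows ::
  "('o, 'm, 'z) category_scheme \<Rightarrow> 'o \<Rightarrow> 'o \<Rightarrow> 'm \<Rightarrow> 'm \<Rightarrow> bool" where
  "inverse_arrows C A B f g \<longleftrightarrow> f \<in> Hom C A B \<and> g \<in> Hom C B A \<and>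
     f \<Zsemi>\<^bsub>C\<^esub> g = Ide C A \<and> g \<Zsemi>\<^bsub>C\<^esub> f = Ide C B"

definition isomorphism ::
  "('o, 'm, 'z) category_scheme \<Rightarrow> 'o \<Rightarrow> 'o \<Rightarrow> 'm \<Rightarrow> bool" where
  "isomorphism C A B f \<longleftrightarrow> (\<exists>g. inverse_arrows C A B f g)"

definition isomorphic :: "('o, 'm, 'z) category_scheme \<Rightarrow> 'o \<Rightarrow> 'o \<Rightarrow> bool" where
  "isomorphic C A B \<longleftrightarrow> (\<exists>f. isomorphism C A B f)"

text \<open>A functor is given by its object map \<open>F\<^sub>0\<close> and its arrow map \<open>F\<^sub>1\<close>.\<close>

definition is_functor ::
  "('o, 'm, 'z) category_scheme \<Rightarrow> ('p, 'n, 'y) category_scheme \<Rightarrow>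
   ('o \<Rightarrow> 'p) \<Rightarrow> ('m \<Rightarrow> 'n) \<Rightarrow> bool" where
  "is_functor C D F\<^sub>0 F\<^sub>1 \<longleftrightarrow>
     (\<forall>A\<in>Obj C. F\<^sub>0 A \<in> Obj D) \<and>
     (\<forall>A B. \<forall>f\<in>Hom C A B. F\<^sub>1 f \<in> Hom D (F\<^sub>0 A) (F\<^sub>0 B)) \<and>
     (\<forall>A\<in>Obj C. F\<^sub>1 (Ide C A) = Ide D (F\<^sub>0 A)) \<and>
     (\<forall>A B E. \<forall>f\<in>Hom C A B. \<forall>g\<in>Hom C B E. F\<^sub>1 (f \<Zsemi>\<^bsub>C\<^esub> g) = F\<^sub>1 f \<Zsemi>\<^bsub>D\<^esub> F\<^sub>1 g)"

definition natural_transformation ::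
  "('o, 'm, 'z) category_scheme \<Rightarrow> ('p, 'n, 'y) category_scheme \<Rightarrow>
   ('o \<Rightarrow> 'p) \<Rightarrow> ('m \<Rightarrow> 'n) \<Rightarrow> ('o \<Rightarrow> 'p) \<Rightarrow> ('m \<Rightarrow> 'n) \<Rightarrow> ('o \<Rightarrow> 'n) \<Rightarrow> bool" where
  "natural_transformation C D F\<^sub>0 F\<^sub>1 G\<^sub>0 G\<^sub>1 \<eta> \<longleftrightarrow>
     is_functor C D F\<^sub>0 F\<^sub>1 \<and> is_functor C D G\<^sub>0 G\<^sub>1 \<and>
     (\<forall>A\<in>Obj C. \<eta> A \<in> Hom D (F\<^sub>0 A) (G\<^sub>0 A)) \<and>
     (\<forall>A B. \<forall>f\<in>Hom C A B. F\<^sub>1 f \<Zsemi>\<^bsub>D\<^esub> \<eta> B = \<eta> A \<Zsemi>\<^bsub>D\<^esub> G\<^sub>1 f)"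

definition natural_isomorphism ::
  "('o, 'm, 'z) category_scheme \<Rightarrow> ('p, 'n, 'y) category_scheme \<Rightarrow>
   ('o \<Rightarrow> 'p) \<Rightarrow> ('m \<Rightarrow> 'n) \<Rightarrow> ('o \<Rightarrow> 'p) \<Rightarrow> ('m \<Rightarrow> 'n) \<Rightarrow> ('o \<Rightarrow> 'n) \<Rightarrow> bool" where
  "natural_isomorphism C D F\<^sub>0 F\<^sub>1 G\<^sub>0 G\<^sub>1 \<eta> \<longleftrightarrow>
     natural_transformation C D F\<^sub>0 F\<^sub>1 G\<^sub>0 G\<^sub>1 \<eta> \<and>
     (\<forall>A\<in>Obj C. isomorphism D (F\<^sub>0 A) (G\<^sub>0 A) (\<eta> A))"

definition prod_category ::
  "('o, 'm, 'z) category_scheme \<Rightarrow> ('p, 'n, 'y) category_scheme \<Rightarrow> ('o \<times> 'p, 'm \<times> 'n) category"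
  where
  "prod_category C D =
     \<lparr>Obj = Obj C \<times> Obj D, Arr = Arr C \<times> Arr D,
      Dom = (\<lambda>(f, g). (Dom C f, Dom D g)), Cod = (\<lambda>(f, g). (Cod C f, Cod D g)),
      Ide = (\<lambda>(A, B). (Ide C A, Ide D B)),
      Comp = (\<lambda>(f, g) (f', g'). (f \<Zsemi>\<^bsub>C\<^esub> f', g \<Zsemi>\<^bsub>D\<^esub> g'))\<rparr>"


section \<open>Additive symmetric monoidal categories\<close>

record ('o, 'm) smc = "('o, 'm) category" +
  tensor_ob :: "'o \<Rightarrow> 'o \<Rightarrow> 'o"  (infixl \<open>\<otimes>\<^sub>o\<index>\<close> 70)
  tensor_arr :: "'m \<Rightarrow> 'm \<Rightarrow> 'm"  (infixl \<open>\<otimes>\<^sub>m\<index>\<close> 70)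
  tensor_unit :: 'o  (\<open>\<I>\<index>\<close>)
  symm :: "'o \<Rightarrow> 'o \<Rightarrow> 'm"

locale strict_symmetric_monoidal_category = category L
  for L :: "('o, 'm, 'z) smc_scheme" (structure) +
  assumes tensor_functor:
      "is_functor (prod_category L L) L (\<lambda>(A, B). A \<otimes>\<^sub>o B) (\<lambda>(f, g). f \<otimes>\<^sub>m g)"
    and unit_obj: "\<I> \<in> Obj L"
    and tensor_ob_assoc: "A \<in> Obj L \<Longrightarrow> B \<in> Obj L \<Longrightarrow> C \<in> Obj L \<Longrightarrow>
      (A \<otimes>\<^sub>o B) \<otimes>\<^sub>o C = A \<otimes>\<^sub>o (B \<otimes>\<^sub>o C)"
    and tensor_ob_unit: "A \<in> Obj L \<Longrightarrow> \<I> \<otimes>\<^sub>o A = A" "A \<in> Obj L \<Longrightarrow> A \<otimes>\<^sub>o \<I> = A"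
    and tensor_arr_assoc: "f \<in> Arr L \<Longrightarrow> g \<in> Arr L \<Longrightarrow> h \<in> Arr L \<Longrightarrow>
      (f \<otimes>\<^sub>m g) \<otimes>\<^sub>m h = f \<otimes>\<^sub>m (g \<otimes>\<^sub>m h)"
    and tensor_arr_unit:
      "f \<in> Arr L \<Longrightarrow> Ide L \<I> \<otimes>\<^sub>m f = f" "f \<in> Arr L \<Longrightarrow> f \<otimes>\<^sub>m Ide L \<I> = f"
    and symm_natural:
      "natural_transformation (prod_category L L) L
         (\<lambda>(A, B). A \<otimes>\<^sub>o B) (\<lambda>(f, g). f \<otimes>\<^sub>m g)
         (\<lambda>(A, B). B \<otimes>\<^sub>o A) (\<lambda>(f, g). g \<otimes>\<^sub>m f) (\<lambda>(A, B). symm L A B)"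
    and symm_symm: "A \<in> Obj L \<Longrightarrow> B \<in> Obj L \<Longrightarrow>
      symm L A B \<Zsemi> symm L B A = Ide L (A \<otimes>\<^sub>o B)"
    and symm_unit: "A \<in> Obj L \<Longrightarrow> symm L A \<I> = Ide L A"
    and hexagon: "A \<in> Obj L \<Longrightarrow> B \<in> Obj L \<Longrightarrow> C \<in> Obj L \<Longrightarrow>
      symm L A (B \<otimes>\<^sub>o C) = (symm L A B \<otimes>\<^sub>m Ide L C) \<Zsemi> (Ide L B \<otimes>\<^sub>m symm L A C)"

record ('o, 'm) additive_smc = "('o, 'm) smc" +
  hadd :: "'m \<Rightarrow> 'm \<Rightarrow> 'm"  (infixl \<open>+\<^sub>m\<index>\<close> 58)
  hzero :: "'o \<Rightarrow> 'o \<Rightarrow> 'm"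

definition hom_monoid :: "('o, 'm, 'z) additive_smc_scheme \<Rightarrow> 'o \<Rightarrow> 'o \<Rightarrow> 'm monoid" where
  "hom_monoid L A B = \<lparr>carrier = Hom L A B, monoid.mult = hadd L, one = hzero L A B\<rparr>"

text \<open>Finite sums of arrows \<open>A \<rightarrow> B\<close>; the empty sum is the zero arrow \<open>A \<rightarrow> B\<close>.\<close>

definition hsum ::
  "('o, 'm, 'z) additive_smc_scheme \<Rightarrow> 'o \<Rightarrow> 'o \<Rightarrow> ('i \<Rightarrow> 'm) \<Rightarrow> 'i set \<Rightarrow> 'm" where
  "hsum L A B f J = finprod (hom_monoid L A B) f J"

locale additive_symmetric_monoidal_category = strict_symmetric_monoidal_category L
  for L :: "('o, 'm, 'z) additive_smc_scheme" (structure) +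
  assumes hom_comm_monoid: "A \<in> Obj L \<Longrightarrow> B \<in> Obj L \<Longrightarrow> comm_monoid (hom_monoid L A B)"
    and add_comp: "f \<in> Hom L A B \<Longrightarrow> f' \<in> Hom L A B \<Longrightarrow> g \<in> Hom L B C \<Longrightarrow>
      (f +\<^sub>m f') \<Zsemi> g = (f \<Zsemi> g) +\<^sub>m (f' \<Zsemi> g)"
    and comp_add: "f \<in> Hom L A B \<Longrightarrow> g \<in> Hom L B C \<Longrightarrow> g' \<in> Hom L B C \<Longrightarrow>
      f \<Zsemi> (g +\<^sub>m g') = (f \<Zsemi> g) +\<^sub>m (f \<Zsemi> g')"
    and zero_comp: "A \<in> Obj L \<Longrightarrow> g \<in> Hom L B C \<Longrightarrow> hzero L A B \<Zsemi> g = hzero L A C"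
    and comp_zero: "f \<in> Hom L A B \<Longrightarrow> C \<in> Obj L \<Longrightarrow> f \<Zsemi> hzero L B C = hzero L A C"
    and add_tensor: "f \<in> Hom L A B \<Longrightarrow> f' \<in> Hom L A B \<Longrightarrow> g \<in> Hom L C D \<Longrightarrow>
      (f +\<^sub>m f') \<otimes>\<^sub>m g = (f \<otimes>\<^sub>m g) +\<^sub>m (f' \<otimes>\<^sub>m g)"
    and tensor_add: "f \<in> Hom L A B \<Longrightarrow> g \<in> Hom L C D \<Longrightarrow> g' \<in> Hom L C D \<Longrightarrow>
      f \<otimes>\<^sub>m (g +\<^sub>m g') = (f \<otimes>\<^sub>m g) +\<^sub>m (f \<otimes>\<^sub>m g')"
    and zero_tensor: "A \<in> Obj L \<Longrightarrow> B \<in> Obj L \<Longrightarrow> g \<in> Hom L C D \<Longrightarrow>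
      hzero L A B \<otimes>\<^sub>m g = hzero L (A \<otimes>\<^sub>o C) (B \<otimes>\<^sub>o D)"
    and tensor_zero: "f \<in> Hom L A B \<Longrightarrow> C \<in> Obj L \<Longrightarrow> D \<in> Obj L \<Longrightarrow>
      f \<otimes>\<^sub>m hzero L C D = hzero L (A \<otimes>\<^sub>o C) (B \<otimes>\<^sub>o D)"


section \<open>Finite biproducts\<close>

definition zero_object :: "('o, 'm, 'z) category_scheme \<Rightarrow> 'o \<Rightarrow> bool" where
  "zero_object C Z \<longleftrightarrow> Z \<in> Obj C \<and> (\<forall>A\<in>Obj C. (\<exists>!f. f \<in> Hom C A Z) \<and> (\<exists>!f. f \<in> Hom C Z A))"

definition biproduct ::
  "('o, 'm, 'z) additive_smc_scheme \<Rightarrow> 'i set \<Rightarrow> ('i \<Rightarrow> 'o) \<Rightarrow> 'o \<Rightarrow> ('i \<Rightarrow> 'm) \<Rightarrow> ('i \<Rightarrow> 'm) \<Rightarrow> bool"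
  where
  "biproduct L J X S \<pi> \<iota> \<longleftrightarrow>
     S \<in> Obj L \<and> (\<forall>j\<in>J. \<pi> j \<in> Hom L S (X j) \<and> \<iota> j \<in> Hom L (X j) S) \<and>
     (\<forall>i\<in>J. \<forall>j\<in>J. \<iota> i \<Zsemi>\<^bsub>L\<^esub> \<pi> j = (if i = j then Ide L (X i) else hzero L (X i) (X j))) \<and>
     hsum L S S (\<lambda>j. \<pi> j \<Zsemi>\<^bsub>L\<^esub> \<iota> j) J = Ide L S"

text \<open>
  A choice of biproduct, with projections and injections, for every finite family of objects
  with indices in \<open>'i\<close>.  Families are pairs of an index set and a function; only the values of
  the function on that set are relevant to \<open>has_finite_biproducts\<close>.
\<close>

record ('i, 'o, 'm) biproducts =
  bsum :: "'i set \<Rightarrow> ('i \<Rightarrow> 'o) \<Rightarrow> 'o"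
  bproj :: "'i set \<Rightarrow> ('i \<Rightarrow> 'o) \<Rightarrow> 'i \<Rightarrow> 'm"
  binj :: "'i set \<Rightarrow> ('i \<Rightarrow> 'o) \<Rightarrow> 'i \<Rightarrow> 'm"

definition has_finite_biproducts ::
  "('o, 'm, 'z) additive_smc_scheme \<Rightarrow> ('i, 'o, 'm) biproducts \<Rightarrow> bool" where
  "has_finite_biproducts L P \<longleftrightarrow>
     (\<forall>J X. finite J \<longrightarrow> (\<forall>j\<in>J. X j \<in> Obj L) \<longrightarrow>
        biproduct L J X (bsum P J X) (bproj P J X) (binj P J X))"

text \<open>The action of \<open>\<Oplus>\<close> on a family of arrows \<open>f j : X j \<rightarrow> Y j\<close>.\<close>

definition bmap ::
  "('o, 'm, 'z) additive_smc_scheme \<Rightarrow> ('i, 'o, 'm) biproducts \<Rightarrow>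
   'i set \<Rightarrow> ('i \<Rightarrow> 'o) \<Rightarrow> ('i \<Rightarrow> 'o) \<Rightarrow> ('i \<Rightarrow> 'm) \<Rightarrow> 'm" where
  "bmap L P J X Y f =
     hsum L (bsum P J X) (bsum P J Y) (\<lambda>j. bproj P J X j \<Zsemi>\<^bsub>L\<^esub> f j \<Zsemi>\<^bsub>L\<^esub> binj P J Y j) J"

text \<open>Binary biproducts are those indexed by \<open>{0, 1}\<close>.\<close>

definition two :: "'a \<Rightarrow> 'a \<Rightarrow> nat \<Rightarrow> 'a" where
  "two x y j = (if j = 0 then x else y)"

definition bsum2 :: "(nat, 'o, 'm) biproducts \<Rightarrow> 'o \<Rightarrow> 'o \<Rightarrow> 'o" where
  "bsum2 P A B = bsum P {0, 1} (two A B)"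

definition bproj2 :: "(nat, 'o, 'm) biproducts \<Rightarrow> 'o \<Rightarrow> 'o \<Rightarrow> nat \<Rightarrow> 'm" where
  "bproj2 P A B = bproj P {0, 1} (two A B)"

definition binj2 :: "(nat, 'o, 'm) biproducts \<Rightarrow> 'o \<Rightarrow> 'o \<Rightarrow> nat \<Rightarrow> 'm" where
  "binj2 P A B = binj P {0, 1} (two A B)"

definition bmap2 ::
  "('o, 'm, 'z) additive_smc_scheme \<Rightarrow> (nat, 'o, 'm) biproducts \<Rightarrow> 'm \<Rightarrow> 'm \<Rightarrow> 'm" where
  "bmap2 L P f g =
     bmap L P {0, 1} (two (Dom L f) (Dom L g)) (two (Cod L f) (Cod L g)) (two f g)"


section \<open>Graded modalities\<close>

record ('r, 'o, 'm) coalgebra_modality =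
  bang_ob :: "'r \<Rightarrow> 'o \<Rightarrow> 'o"
  bang_arr :: "'r \<Rightarrow> 'm \<Rightarrow> 'm"
  digging :: "'r \<Rightarrow> 'r \<Rightarrow> 'o \<Rightarrow> 'm"
  dereliction :: "'o \<Rightarrow> 'm"
  contraction :: "'r \<Rightarrow> 'r \<Rightarrow> 'o \<Rightarrow> 'm"
  weakening :: "'o \<Rightarrow> 'm"

locale graded_coalgebra_modality = strict_symmetric_monoidal_category L
  for L :: "('o, 'm, 'z) smc_scheme" (structure) +
  fixes M :: "('r :: {semiring_0, monoid_mult}, 'o, 'm, 'y) coalgebra_modality_scheme"
  assumes bang_functor: "is_functor L L (bang_ob M r) (bang_arr M r)"
    and digging_natural:
      "natural_transformation L L (bang_ob M (r * s)) (bang_arr M (r * s))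
         (\<lambda>A. bang_ob M r (bang_ob M s A)) (\<lambda>f. bang_arr M r (bang_arr M s f)) (digging M r s)"
    and dereliction_natural:
      "natural_transformation L L (bang_ob M 1) (bang_arr M 1) (\<lambda>A. A) (\<lambda>f. f) (dereliction M)"
    and contraction_natural:
      "natural_transformation L L (bang_ob M (r + s)) (bang_arr M (r + s))
         (\<lambda>A. bang_ob M r A \<otimes>\<^sub>o bang_ob M s A) (\<lambda>f. bang_arr M r f \<otimes>\<^sub>m bang_arr M s f)
         (contraction M r s)"
    and weakening_natural:
      "natural_transformation L L (bang_ob M 0) (bang_arr M 0) (\<lambda>A. \<I>) (\<lambda>f. Ide L \<I>)
         (weakening M)"
    and digging_assoc: "A \<in> Obj L \<Longrightarrow>
      digging M (r * s) t A \<Zsemi> digging M r s (bang_ob M t A) =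
      digging M r (s * t) A \<Zsemi> bang_arr M r (digging M s t A)"
    and digging_counit: "A \<in> Obj L \<Longrightarrow>
      digging M 1 r A \<Zsemi> dereliction M (bang_ob M r A) = Ide L (bang_ob M r A)"
      "A \<in> Obj L \<Longrightarrow>
      digging M r 1 A \<Zsemi> bang_arr M r (dereliction M A) = Ide L (bang_ob M r A)"
    and contraction_assoc: "A \<in> Obj L \<Longrightarrow>
      contraction M (r + s) t A \<Zsemi> (contraction M r s A \<otimes>\<^sub>m Ide L (bang_ob M t A)) =
      contraction M r (s + t) A \<Zsemi> (Ide L (bang_ob M r A) \<otimes>\<^sub>m contraction M s t A)"
    and contraction_counit: "A \<in> Obj L \<Longrightarrow>
      contraction M 0 r A \<Zsemi> (weakening M A \<otimes>\<^sub>m Ide L (bang_ob M r A)) = Ide L (bang_ob M r A)"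
      "A \<in> Obj L \<Longrightarrow>
      contraction M r 0 A \<Zsemi> (Ide L (bang_ob M r A) \<otimes>\<^sub>m weakening M A) = Ide L (bang_ob M r A)"
    and contraction_cocomm: "A \<in> Obj L \<Longrightarrow>
      contraction M r s A \<Zsemi> symm L (bang_ob M r A) (bang_ob M s A) = contraction M s r A"
    and digging_contraction: "A \<in> Obj L \<Longrightarrow>
      digging M (r + s) t A \<Zsemi> contraction M r s (bang_ob M t A) =
      contraction M (r * t) (s * t) A \<Zsemi> (digging M r t A \<otimes>\<^sub>m digging M s t A)"
    and digging_weakening: "A \<in> Obj L \<Longrightarrow>
      digging M 0 t A \<Zsemi> weakening M (bang_ob M t A) = weakening M A"

record ('r, 'o, 'm) bialgebra_modality = "('r, 'o, 'm) coalgebra_modality" +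
  cocontraction :: "'r \<Rightarrow> 'r \<Rightarrow> 'o \<Rightarrow> 'm"
  coweakening :: "'o \<Rightarrow> 'm"

definition splits :: "'r :: plus \<Rightarrow> ('r \<times> 'r) set" where
  "splits r = {(s, t). s + t = r}"

locale graded_additive_bialgebra_modality =
  additive_symmetric_monoidal_category L + graded_coalgebra_modality L M
  for L :: "('o, 'm, 'z) additive_smc_scheme" (structure)
    and M :: "('r :: fas_semiring, 'o, 'm, 'y) bialgebra_modality_scheme" +
  assumes cocontraction_natural:
      "natural_transformation L L
         (\<lambda>A. bang_ob M r A \<otimes>\<^sub>o bang_ob M s A) (\<lambda>f. bang_arr M r f \<otimes>\<^sub>m bang_arr M s f)
         (bang_ob M (r + s)) (bang_arr M (r + s)) (cocontraction M r s)"
    and coweakening_natural: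
      "natural_transformation L L (\<lambda>A. \<I>) (\<lambda>f. Ide L \<I>) (bang_ob M 0) (bang_arr M 0)
         (coweakening M)"
    and cocontraction_assoc: "A \<in> Obj L \<Longrightarrow>
      (cocontraction M r s A \<otimes>\<^sub>m Ide L (bang_ob M t A)) \<Zsemi> cocontraction M (r + s) t A =
      (Ide L (bang_ob M r A) \<otimes>\<^sub>m cocontraction M s t A) \<Zsemi> cocontraction M r (s + t) A"
    and cocontraction_unit: "A \<in> Obj L \<Longrightarrow>
      (coweakening M A \<otimes>\<^sub>m Ide L (bang_ob M r A)) \<Zsemi> cocontraction M 0 r A = Ide L (bang_ob M r A)"
      "A \<in> Obj L \<Longrightarrow>
      (Ide L (bang_ob M r A) \<otimes>\<^sub>m coweakening M A) \<Zsemi> cocontraction M r 0 A = Ide L (bang_ob M r A)"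
    and cocontraction_comm: "A \<in> Obj L \<Longrightarrow>
      symm L (bang_ob M r A) (bang_ob M s A) \<Zsemi> cocontraction M s r A = cocontraction M r s A"
    and cocontraction_contraction: "A \<in> Obj L \<Longrightarrow> r + s = t + u \<Longrightarrow>
      cocontraction M r s A \<Zsemi> contraction M t u A =
      hsum L (bang_ob M r A \<otimes>\<^sub>o bang_ob M s A) (bang_ob M t A \<otimes>\<^sub>o bang_ob M u A)
        (\<lambda>(a, b, c, d).
           (contraction M a b A \<otimes>\<^sub>m contraction M c d A) \<Zsemi>
           (Ide L (bang_ob M a A) \<otimes>\<^sub>m symm L (bang_ob M b A) (bang_ob M c A)
              \<otimes>\<^sub>m Ide L (bang_ob M d A)) \<Zsemi>
           (cocontraction M a c A \<otimes>\<^sub>m cocontraction M b d A))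
        {(a, b, c, d). a + b = r \<and> c + d = s \<and> a + c = t \<and> b + d = u}"
    and coweakening_weakening: "A \<in> Obj L \<Longrightarrow> coweakening M A \<Zsemi> weakening M A = Ide L \<I>"
    and coweakening_contraction: "A \<in> Obj L \<Longrightarrow>
      coweakening M A \<Zsemi> contraction M 0 0 A = coweakening M A \<otimes>\<^sub>m coweakening M A"
    and cocontraction_weakening: "A \<in> Obj L \<Longrightarrow>
      cocontraction M 0 0 A \<Zsemi> weakening M A = weakening M A \<otimes>\<^sub>m weakening M A"
    and cocontraction_dereliction: "A \<in> Obj L \<Longrightarrow> r + s = 1 \<Longrightarrow>
      cocontraction M r s A \<Zsemi> dereliction M A =
        (if r = 0 then weakening M A \<otimes>\<^sub>m dereliction M A
         else hzero L (bang_ob M r A \<otimes>\<^sub>o bang_ob M s A) A) +\<^sub>m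
        (if s = 0 then dereliction M A \<otimes>\<^sub>m weakening M A
         else hzero L (bang_ob M r A \<otimes>\<^sub>o bang_ob M s A) A)"
    and bang_add: "f \<in> Hom L A B \<Longrightarrow> g \<in> Hom L A B \<Longrightarrow>
      bang_arr M r (f +\<^sub>m g) =
      hsum L (bang_ob M r A) (bang_ob M r B)
        (\<lambda>(s, t). contraction M s t A \<Zsemi> (bang_arr M s f \<otimes>\<^sub>m bang_arr M t g) \<Zsemi>
           cocontraction M s t B) (splits r)"
    and bang_zero: "A \<in> Obj L \<Longrightarrow> B \<in> Obj L \<Longrightarrow>
      bang_arr M r (hzero L A B) =
      (if r = 0 then weakening M A \<Zsemi> coweakening M B
       else hzero L (bang_ob M r A) (bang_ob M r B))"


section \<open>The Seely transformations\<close>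

text \<open>
  \<open>P\<close> supplies the binary biproducts and \<open>Q\<close> those indexed by \<^term>\<open>splits r\<close>; they are separate
  parameters only because their index types differ.
\<close>

definition seely_family ::
  "('o, 'm, 'z) additive_smc_scheme \<Rightarrow> ('r, 'o, 'm, 'y) coalgebra_modality_scheme \<Rightarrow>
   'o \<Rightarrow> 'o \<Rightarrow> 'r \<times> 'r \<Rightarrow> 'o" where
  "seely_family L M A B = (\<lambda>(s, t). bang_ob M s A \<otimes>\<^sub>o\<^bsub>L\<^esub> bang_ob M t B)"

definition seely_ob ::
  "('o, 'm, 'z) additive_smc_scheme \<Rightarrow> ('r :: plus, 'o, 'm, 'y) coalgebra_modality_scheme \<Rightarrow>
   ('r \<times> 'r, 'o, 'm) biproducts \<Rightarrow> 'r \<Rightarrow> 'o \<Rightarrow> 'o \<Rightarrow> 'o" where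
  "seely_ob L M Q r A B = bsum Q (splits r) (seely_family L M A B)"

definition seely_arr ::
  "('o, 'm, 'z) additive_smc_scheme \<Rightarrow> ('r :: plus, 'o, 'm, 'y) coalgebra_modality_scheme \<Rightarrow>
   ('r \<times> 'r, 'o, 'm) biproducts \<Rightarrow> 'r \<Rightarrow> 'm \<Rightarrow> 'm \<Rightarrow> 'm" where
  "seely_arr L M Q r f g =
     bmap L Q (splits r)
       (seely_family L M (Dom L f) (Dom L g)) (seely_family L M (Cod L f) (Cod L g))
       (\<lambda>(s, t). bang_arr M s f \<otimes>\<^sub>m\<^bsub>L\<^esub> bang_arr M t g)"

definition chi_tensor ::
  "('o, 'm, 'z) additive_smc_scheme \<Rightarrow> ('r :: plus, 'o, 'm, 'y) coalgebra_modality_scheme \<Rightarrow>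
   (nat, 'o, 'm) biproducts \<Rightarrow> ('r \<times> 'r, 'o, 'm) biproducts \<Rightarrow> 'r \<Rightarrow> 'o \<Rightarrow> 'o \<Rightarrow> 'm" where
  "chi_tensor L M P Q r A B =
     hsum L (bang_ob M r (bsum2 P A B)) (seely_ob L M Q r A B)
       (\<lambda>(s, t). contraction M s t (bsum2 P A B) \<Zsemi>\<^bsub>L\<^esub>
          (bang_arr M s (bproj2 P A B 0) \<otimes>\<^sub>m\<^bsub>L\<^esub> bang_arr M t (bproj2 P A B 1)) \<Zsemi>\<^bsub>L\<^esub>
          binj Q (splits r) (seely_family L M A B) (s, t))
       (splits r)"

definition chi_tensor_inv ::
  "('o, 'm, 'z) additive_smc_scheme \<Rightarrow> ('r :: plus, 'o, 'm, 'y) bialgebra_modality_scheme \<Rightarrow>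
   (nat, 'o, 'm) biproducts \<Rightarrow> ('r \<times> 'r, 'o, 'm) biproducts \<Rightarrow> 'r \<Rightarrow> 'o \<Rightarrow> 'o \<Rightarrow> 'm" where
  "chi_tensor_inv L M P Q r A B =
     hsum L (seely_ob L M Q r A B) (bang_ob M r (bsum2 P A B))
       (\<lambda>(s, t). bproj Q (splits r) (seely_family L M A B) (s, t) \<Zsemi>\<^bsub>L\<^esub>
          (bang_arr M s (binj2 P A B 0) \<otimes>\<^sub>m\<^bsub>L\<^esub> bang_arr M t (binj2 P A B 1)) \<Zsemi>\<^bsub>L\<^esub>
          cocontraction M s t (bsum2 P A B))
       (splits r)"

definition chi_unit :: "('r, 'o, 'm, 'y) coalgebra_modality_scheme \<Rightarrow> 'o \<Rightarrow> 'm" where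
  "chi_unit M Z = weakening M Z"

definition chi_unit_inv :: "('r, 'o, 'm, 'y) bialgebra_modality_scheme \<Rightarrow> 'o \<Rightarrow> 'm" where
  "chi_unit_inv M Z = coweakening M Z"

end

theory Submission
  imports Defs
begin

text \<open>Maps into and out of the biproduct over the splits of \<open>r\<close> are determined by their components, so
  both composites reduce to the families \<open>c\<^bsub>s,t\<^esub> ; (!\<pi>\<^sub>0 \<otimes> !\<pi>\<^sub>1)\<close> and \<open>(!\<iota>\<^sub>0 \<otimes> !\<iota>\<^sub>1) ; c'\<^bsub>s,t\<^esub>\<close>, where
  \<open>c'\<close> is cocontraction.  Composing them at equal indices and summing gives \<open>!\<^sub>r\<close> of
  \<open>\<pi>\<^sub>0 ; \<iota>\<^sub>0 + \<pi>\<^sub>1 ; \<iota>\<^sub>1 = 1\<close>.  In the other order, the bimonoid law together with \<open>\<iota>\<^sub>0 ; \<pi>\<^sub>1 = 0\<close>,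
  \<open>\<iota>\<^sub>1 ; \<pi>\<^sub>0 = 0\<close> and \<open>!\<^sub>a(0) = 0\<close> for \<open>a \<noteq> 0\<close> leaves only the summand in which nothing crosses the
  symmetry, that is, the identity on the diagonal and zero off it.  For the unit,
  \<open>w ; w' = !\<^sub>0(0) = !\<^sub>0(1) = 1\<close> on a zero object.\<close>

text \<open>The index \<open>1\<close> of binary biproducts must stay literally \<open>1\<close>;
  otherwise the simplifier would turn it into \<open>Suc 0\<close> and facts about
  \<open>bproj2 P A B 1\<close> would no longer match.\<close>

declare One_nat_def [simp del]

section \<open>Composition and tensor\<close>

context category
begin

lemma Hom_iff: "f \<in> Hom L A B \<longleftrightarrow> f \<in> Arr L \<and> Dom L f = A \<and> Cod L f = B"
  by (simp add: Hom_def)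

lemma Dom_Obj: "f \<in> Arr L \<Longrightarrow> Dom L f \<in> Obj L"
  and Cod_Obj: "f \<in> Arr L \<Longrightarrow> Cod L f \<in> Obj L"
  using arr_obj by auto

lemma Hom_Obj:
  assumes "f \<in> Hom L A B"
  shows "A \<in> Obj L" "B \<in> Obj L"
  using assms arr_obj by (auto simp: Hom_iff)

lemma comp_Arr:
  assumes "f \<in> Arr L" "g \<in> Arr L" "Cod L f = Dom L g"
  shows "f \<Zsemi> g \<in> Arr L" "Dom L (f \<Zsemi> g) = Dom L f" "Cod L (f \<Zsemi> g) = Cod L g"
  using comp_hom[of f "Dom L f" "Cod L f" g "Cod L g"] assms by (auto simp: Hom_iff)

lemma Ide_Arr:
  assumes "A \<in> Obj L"
  shows "Ide L A \<in> Arr L" "Dom L (Ide L A) = A" "Cod L (Ide L A) = A"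
  using ide_hom[OF assms] by (auto simp: Hom_iff)

lemma comp_assoc_Arr:
  assumes "f \<in> Arr L" "g \<in> Arr L" "h \<in> Arr L" "Cod L f = Dom L g" "Cod L g = Dom L h"
  shows "(f \<Zsemi> g) \<Zsemi> h = f \<Zsemi> (g \<Zsemi> h)"
  by (rule comp_assoc) (use assms in \<open>auto simp: Hom_iff\<close>)

lemma Ide_comp: "f \<in> Arr L \<Longrightarrow> Dom L f = A \<Longrightarrow> Ide L A \<Zsemi> f = f"
  using ide_comp by (auto simp: Hom_iff)

lemma comp_Ide: "f \<in> Arr L \<Longrightarrow> Cod L f = A \<Longrightarrow> f \<Zsemi> Ide L A = f"
  using comp_ide by (auto simp: Hom_iff)

text \<open>Typing by rewriting: with hom sets split into \<open>Arr\<close>, \<open>Dom\<close> and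
  \<open>Cod\<close>, the simplifier can discharge composability conditions itself. Associativity is
  left out, since later proofs use it in both directions.\<close>

lemmas cat_simps = Dom_Obj Cod_Obj comp_Arr Ide_Arr Ide_comp comp_Ide

end

section \<open>The tensor product and the symmetry, in typed-arrow form\<close>

context strict_symmetric_monoidal_category
begin

lemma tensor_Obj: "A \<in> Obj L \<Longrightarrow> B \<in> Obj L \<Longrightarrow> A \<otimes>\<^sub>o B \<in> Obj L"
  using tensor_functor by (auto simp: is_functor_def prod_category_def)

lemma tensor_Arr:
  assumes "f \<in> Arr L" "g \<in> Arr L"
  shows "f \<otimes>\<^sub>m g \<in> Arr L" "Dom L (f \<otimes>\<^sub>m g) = Dom L f \<otimes>\<^sub>o Dom L g"
    "Cod L (f \<otimes>\<^sub>m g) = Cod L f \<otimes>\<^sub>o Cod L g"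
  using tensor_functor assms by (auto simp: is_functor_def prod_category_def Hom_def)

lemma tensor_Ide: "A \<in> Obj L \<Longrightarrow> B \<in> Obj L \<Longrightarrow> Ide L A \<otimes>\<^sub>m Ide L B = Ide L (A \<otimes>\<^sub>o B)"
  using tensor_functor by (auto simp: is_functor_def prod_category_def)

lemma interchange:
  assumes "f \<in> Arr L" "g \<in> Arr L" "h \<in> Arr L" "k \<in> Arr L"
    "Cod L f = Dom L h" "Cod L g = Dom L k"
  shows "(f \<otimes>\<^sub>m g) \<Zsemi> (h \<otimes>\<^sub>m k) = (f \<Zsemi> h) \<otimes>\<^sub>m (g \<Zsemi> k)"
  using tensor_functor assms by (auto simp: is_functor_def prod_category_def Hom_def)

lemma symm_Arr:
  assumes "A \<in> Obj L" "B \<in> Obj L"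
  shows "symm L A B \<in> Arr L" "Dom L (symm L A B) = A \<otimes>\<^sub>o B" "Cod L (symm L A B) = B \<otimes>\<^sub>o A"
  using symm_natural assms by (auto simp: natural_transformation_def prod_category_def Hom_def)

lemma symm_naturality:
  assumes "f \<in> Arr L" "g \<in> Arr L"
  shows "(f \<otimes>\<^sub>m g) \<Zsemi> symm L (Cod L f) (Cod L g) = symm L (Dom L f) (Dom L g) \<Zsemi> (g \<otimes>\<^sub>m f)"
  using symm_natural assms by (auto simp: natural_transformation_def prod_category_def Hom_def)

lemmas mon_simps = cat_simps tensor_Obj tensor_Arr tensor_Ide symm_Arr unit_obj tensor_ob_unit

text \<open>Strict associativity rebrackets both fourfold tensors so that the two middle factors
  stand together. Interchange then separates the outer factors, and what remains is naturality of
  \<open>symm\<close> at \<open>q\<close> and \<open>x\<close>.\<close>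

lemma middle_symm_naturality:
  assumes "p \<in> Arr L" "q \<in> Arr L" "x \<in> Arr L" "y \<in> Arr L"
  shows "((p \<otimes>\<^sub>m q) \<otimes>\<^sub>m (x \<otimes>\<^sub>m y)) \<Zsemi>
      (Ide L (Cod L p) \<otimes>\<^sub>m symm L (Cod L q) (Cod L x) \<otimes>\<^sub>m Ide L (Cod L y)) =
    (Ide L (Dom L p) \<otimes>\<^sub>m symm L (Dom L q) (Dom L x) \<otimes>\<^sub>m Ide L (Dom L y)) \<Zsemi>
      ((p \<otimes>\<^sub>m x) \<otimes>\<^sub>m (q \<otimes>\<^sub>m y))"
proof -
  have "(p \<otimes>\<^sub>m q) \<otimes>\<^sub>m (x \<otimes>\<^sub>m y) = p \<otimes>\<^sub>m (q \<otimes>\<^sub>m x) \<otimes>\<^sub>m y"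
    "(p \<otimes>\<^sub>m x) \<otimes>\<^sub>m (q \<otimes>\<^sub>m y) = p \<otimes>\<^sub>m (x \<otimes>\<^sub>m q) \<otimes>\<^sub>m y"
    using assms by (simp_all add: tensor_arr_assoc mon_simps)
  then show ?thesis
    using assms by (simp add: interchange mon_simps symm_naturality)
qed

end

section \<open>Sums of arrows\<close>

context additive_symmetric_monoidal_category
begin

lemma hzero_Hom: "A \<in> Obj L \<Longrightarrow> B \<in> Obj L \<Longrightarrow> hzero L A B \<in> Hom L A B"
  using comm_monoid.axioms(1)[OF hom_comm_monoid] monoid.one_closed
  by (fastforce simp: hom_monoid_def)

lemma hsum_Hom:
  assumes "A \<in> Obj L" "B \<in> Obj L" "\<And>j. j \<in> J \<Longrightarrow> f j \<in> Hom L A B"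
  shows "hsum L A B f J \<in> Hom L A B"
  using comm_monoid.finprod_closed[OF hom_comm_monoid[OF assms(1,2)], of f J] assms(3)
  by (auto simp: hsum_def hom_monoid_def)

lemma hsum_empty: "A \<in> Obj L \<Longrightarrow> B \<in> Obj L \<Longrightarrow> hsum L A B f {} = hzero L A B"
  by (simp add: hsum_def comm_monoid.finprod_empty hom_comm_monoid) (simp add: hom_monoid_def)

lemma hsum_insert:
  assumes "A \<in> Obj L" "B \<in> Obj L" "finite J" "i \<notin> J" "\<And>j. j \<in> insert i J \<Longrightarrow> f j \<in> Hom L A B"
  shows "hsum L A B f (insert i J) = f i +\<^sub>m hsum L A B f J"
  using comm_monoid.finprod_insert[OF hom_comm_monoid[OF assms(1,2)] assms(3,4), of f] assms(5)
  by (auto simp: hsum_def hom_monoid_def)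

lemma hsum_cong:
  assumes "A \<in> Obj L" "B \<in> Obj L" "\<And>j. j \<in> J \<Longrightarrow> g j \<in> Hom L A B" "\<And>j. j \<in> J \<Longrightarrow> f j = g j"
  shows "hsum L A B f J = hsum L A B g J"
  unfolding hsum_def
  by (rule comm_monoid.finprod_cong'[OF hom_comm_monoid[OF assms(1,2)]])
    (use assms in \<open>auto simp: hom_monoid_def\<close>)

lemma hadd_hzero:
  assumes "f \<in> Hom L A B"
  shows "f +\<^sub>m hzero L A B = f" "hzero L A B +\<^sub>m f = f"
proof -
  have "A \<in> Obj L" "B \<in> Obj L" using Hom_Obj assms by auto
  note m = comm_monoid.axioms(1)[OF hom_comm_monoid[OF this]]
  show "f +\<^sub>m hzero L A B = f" "hzero L A B +\<^sub>m f = f"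
    using monoid.r_one[OF m, of f] monoid.l_one[OF m, of f] assms by (auto simp: hom_monoid_def)
qed

lemma hsum_zero:
  assumes "A \<in> Obj L" "B \<in> Obj L" "finite J" "\<And>j. j \<in> J \<Longrightarrow> f j = hzero L A B"
  shows "hsum L A B f J = hzero L A B"
  using assms(3,4)
proof (induction J)
  case empty
  then show ?case by (simp add: hsum_empty assms)
next
  case (insert i J)
  then have "hsum L A B f (insert i J) = f i +\<^sub>m hsum L A B f J"
    by (intro hsum_insert) (auto simp: assms(1,2) hzero_Hom)
  then show ?case using insert by (simp add: hadd_hzero[OF hzero_Hom] assms(1,2))
qed

text \<open>Evaluates sums governed by a Kronecker delta; these come from the equations of a
  biproduct and later from the bimonoid law.\<close>

lemma hsum_single:
  assumes "finite J" "i \<in> J" "f i \<in> Hom L A B" "\<And>j. j \<in> J \<Longrightarrow> j \<noteq> i \<Longrightarrow> f j = hzero L A B"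
  shows "hsum L A B f J = f i"
proof -
  have o: "A \<in> Obj L" "B \<in> Obj L" using Hom_Obj[OF assms(3)] .
  have "hsum L A B f (insert i (J - {i})) = f i +\<^sub>m hsum L A B f (J - {i})"
    by (rule hsum_insert) (use assms o in \<open>auto simp: hzero_Hom\<close>, metis hzero_Hom)
  also have "hsum L A B f (J - {i}) = hzero L A B"
    by (rule hsum_zero) (use assms o in auto)
  finally show ?thesis using assms by (simp add: hadd_hzero insert_absorb)
qed

text \<open>Induction on the index set: preservation of zero settles the empty sum, and preservation
  of binary sums settles the step. The same argument on the other side gives
  \<open>comp_hsum\<close>.\<close>

lemma hsum_comp:
  assumes "finite J" "A \<in> Obj L" "g \<in> Hom L B C" "\<And>j. j \<in> J \<Longrightarrow> f j \<in> Hom L A B"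
  shows "hsum L A B f J \<Zsemi> g = hsum L A C (\<lambda>j. f j \<Zsemi> g) J"
  using assms(1,4)
proof (induction J)
  case empty
  then show ?case using assms by (auto simp: hsum_empty Hom_iff cat_simps zero_comp)
next
  case (insert i J)
  have o: "B \<in> Obj L" "C \<in> Obj L" using Hom_Obj[OF assms(3)] .
  have "hsum L A B f (insert i J) \<Zsemi> g = (f i +\<^sub>m hsum L A B f J) \<Zsemi> g"
    using insert by (subst hsum_insert) (auto simp: assms o)
  also have "\<dots> = (f i \<Zsemi> g) +\<^sub>m (hsum L A B f J \<Zsemi> g)"
    using insert.prems by (intro add_comp[OF _ _ assms(3)]) (auto simp: hsum_Hom assms(2) o)
  also have "\<dots> = hsum L A C (\<lambda>j. f j \<Zsemi> g) (insert i J)"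
    using insert by (subst hsum_insert) (auto simp: assms o intro!: comp_hom[OF _ assms(3)])
  finally show ?case .
qed

lemma comp_hsum:
  assumes "finite J" "C \<in> Obj L" "g \<in> Hom L A B" "\<And>j. j \<in> J \<Longrightarrow> f j \<in> Hom L B C"
  shows "g \<Zsemi> hsum L B C f J = hsum L A C (\<lambda>j. g \<Zsemi> f j) J"
  using assms(1,4)
proof (induction J)
  case empty
  then show ?case using assms by (auto simp: hsum_empty Hom_iff cat_simps comp_zero)
next
  case (insert i J)
  have o: "A \<in> Obj L" "B \<in> Obj L" using Hom_Obj[OF assms(3)] .
  have "g \<Zsemi> hsum L B C f (insert i J) = g \<Zsemi> (f i +\<^sub>m hsum L B C f J)"
    using insert by (subst hsum_insert) (auto simp: assms o)
  also have "\<dots> = (g \<Zsemi> f i) +\<^sub>m (g \<Zsemi> hsum L B C f J)"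
    using insert.prems by (intro comp_add[OF assms(3)]) (auto simp: hsum_Hom assms(2) o)
  also have "\<dots> = hsum L A C (\<lambda>j. g \<Zsemi> f j) (insert i J)"
    using insert by (subst hsum_insert) (auto simp: assms o intro!: comp_hom[OF assms(3)])
  finally show ?case .
qed

section \<open>Biproducts\<close>

lemma biproduct_Hom:
  assumes "biproduct L J X S \<pi> \<iota>" "j \<in> J"
  shows "\<pi> j \<in> Hom L S (X j)" "\<iota> j \<in> Hom L (X j) S" "S \<in> Obj L" "X j \<in> Obj L"
proof -
  show "\<pi> j \<in> Hom L S (X j)" "\<iota> j \<in> Hom L (X j) S"
    using assms by (auto simp: biproduct_def)
  then show "S \<in> Obj L" "X j \<in> Obj L"
    using Hom_Obj by auto
qed

text \<open>The sum is the map into the biproduct with components \<open>f i\<close>. Distributing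
  \<open>\<pi> j\<close> over it produces the factors \<open>\<iota> i \<Zsemi> \<pi> j\<close>,
  which are zero except for \<open>i = j\<close>.\<close>

lemma biproduct_pair_proj:
  assumes "biproduct L J X S \<pi> \<iota>" "finite J" "j \<in> J" "\<And>i. i \<in> J \<Longrightarrow> f i \<in> Hom L A (X i)"
  shows "hsum L A S (\<lambda>i. f i \<Zsemi> \<iota> i) J \<Zsemi> \<pi> j = f j"
proof -
  note b = biproduct_Hom[OF assms(1)]
  have A: "A \<in> Obj L" using Hom_Obj[OF assms(4)[OF assms(3)]] by simp
  have eq: "(f i \<Zsemi> \<iota> i) \<Zsemi> \<pi> j = (if i = j then f j else hzero L A (X j))" if "i \<in> J" for i
  proof -
    have "(f i \<Zsemi> \<iota> i) \<Zsemi> \<pi> j = f i \<Zsemi> (\<iota> i \<Zsemi> \<pi> j)"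
      using comp_assoc b(2) b(1) assms(3,4) that by blast
    also have "\<iota> i \<Zsemi> \<pi> j = (if i = j then Ide L (X i) else hzero L (X i) (X j))"
      using assms(1,3) that by (auto simp: biproduct_def)
    finally show ?thesis
      using comp_ide[OF assms(4)] comp_zero[OF assms(4)] that b(4) assms(3) by auto
  qed
  have "hsum L A S (\<lambda>i. f i \<Zsemi> \<iota> i) J \<Zsemi> \<pi> j = hsum L A (X j) (\<lambda>i. (f i \<Zsemi> \<iota> i) \<Zsemi> \<pi> j) J"
    by (rule hsum_comp) (use b assms A in \<open>auto intro: comp_hom[OF assms(4)]\<close>)
  also have "\<dots> = (f j \<Zsemi> \<iota> j) \<Zsemi> \<pi> j"
    by (rule hsum_single) (use assms eq in auto)
  finally show ?thesis using eq[OF assms(3)] by simp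
qed

lemma biproduct_inj_copair:
  assumes "biproduct L J X S \<pi> \<iota>" "finite J" "j \<in> J" "\<And>i. i \<in> J \<Longrightarrow> g i \<in> Hom L (X i) A"
  shows "\<iota> j \<Zsemi> hsum L S A (\<lambda>i. \<pi> i \<Zsemi> g i) J = g j"
proof -
  note b = biproduct_Hom[OF assms(1)]
  have A: "A \<in> Obj L" using Hom_Obj[OF assms(4)[OF assms(3)]] by simp
  have eq: "\<iota> j \<Zsemi> (\<pi> i \<Zsemi> g i) = (if i = j then g j else hzero L (X j) A)" if "i \<in> J" for i
  proof -
    have "\<iota> j \<Zsemi> (\<pi> i \<Zsemi> g i) = (\<iota> j \<Zsemi> \<pi> i) \<Zsemi> g i"
      using comp_assoc b(2) b(1) assms(3,4) that by metis
    also have "\<iota> j \<Zsemi> \<pi> i = (if i = j then Ide L (X i) else hzero L (X j) (X i))"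
      using assms(1,3) that by (auto simp: biproduct_def)
    finally show ?thesis
      using ide_comp[OF assms(4)] zero_comp[OF _ assms(4)] that b(4) assms(3) by auto
  qed
  have "\<iota> j \<Zsemi> hsum L S A (\<lambda>i. \<pi> i \<Zsemi> g i) J = hsum L (X j) A (\<lambda>i. \<iota> j \<Zsemi> (\<pi> i \<Zsemi> g i)) J"
    by (rule comp_hsum) (use b assms A in \<open>auto intro: comp_hom[OF _ assms(4)]\<close>)
  also have "\<dots> = \<iota> j \<Zsemi> (\<pi> j \<Zsemi> g j)"
    by (rule hsum_single) (use assms eq in auto)
  finally show ?thesis using eq[OF assms(3)] by simp
qed

text \<open>The projections are jointly monic: inserting the decomposition of the identity as the
  sum of all \<open>\<pi> j \<Zsemi> \<iota> j\<close> rebuilds an arrow from its composites with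
  the \<open>\<pi> j\<close>.\<close>

lemma biproduct_proj_eqI:
  assumes "biproduct L J X S \<pi> \<iota>" "finite J" "f \<in> Hom L A S" "g \<in> Hom L A S"
    "\<And>j. j \<in> J \<Longrightarrow> f \<Zsemi> \<pi> j = g \<Zsemi> \<pi> j"
  shows "f = g"
proof -
  note b = biproduct_Hom[OF assms(1)]
  have S: "S \<in> Obj L" using assms(1) by (simp add: biproduct_def)
  have A: "A \<in> Obj L" using Hom_Obj[OF assms(3)] by simp
  have expand: "h = hsum L A S (\<lambda>j. (h \<Zsemi> \<pi> j) \<Zsemi> \<iota> j) J" if h: "h \<in> Hom L A S" for h
  proof -
    have "h = h \<Zsemi> hsum L S S (\<lambda>j. \<pi> j \<Zsemi> \<iota> j) J"
      using assms(1) comp_ide[OF h] by (simp add: biproduct_def)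
    also have "\<dots> = hsum L A S (\<lambda>j. h \<Zsemi> (\<pi> j \<Zsemi> \<iota> j)) J"
      by (rule comp_hsum) (use b assms(2) S h in \<open>auto intro: comp_hom\<close>)
    also have "\<dots> = hsum L A S (\<lambda>j. (h \<Zsemi> \<pi> j) \<Zsemi> \<iota> j) J"
      by (rule hsum_cong)
        (use b A S h comp_assoc[OF h] in \<open>auto intro: comp_hom\<close>, metis)
    finally show ?thesis .
  qed
  have "hsum L A S (\<lambda>j. (f \<Zsemi> \<pi> j) \<Zsemi> \<iota> j) J = hsum L A S (\<lambda>j. (g \<Zsemi> \<pi> j) \<Zsemi> \<iota> j) J"
    by (rule hsum_cong) (use b A S assms in \<open>auto intro: comp_hom\<close>)
  then show ?thesis using expand assms(3,4) by metis
qed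

text \<open>Dually, the injections are jointly epic, because the same decomposition of the identity
  can be inserted in front of an arrow.\<close>

lemma biproduct_inj_eqI:
  assumes "biproduct L J X S \<pi> \<iota>" "finite J" "f \<in> Hom L S A" "g \<in> Hom L S A"
    "\<And>j. j \<in> J \<Longrightarrow> \<iota> j \<Zsemi> f = \<iota> j \<Zsemi> g"
  shows "f = g"
proof -
  note b = biproduct_Hom[OF assms(1)]
  have S: "S \<in> Obj L" using assms(1) by (simp add: biproduct_def)
  have A: "A \<in> Obj L" using Hom_Obj[OF assms(3)] by simp
  have expand: "h = hsum L S A (\<lambda>j. \<pi> j \<Zsemi> (\<iota> j \<Zsemi> h)) J" if h: "h \<in> Hom L S A" for h
  proof -
    have "h = hsum L S S (\<lambda>j. \<pi> j \<Zsemi> \<iota> j) J \<Zsemi> h"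
      using assms(1) ide_comp[OF h] by (simp add: biproduct_def)
    also have "\<dots> = hsum L S A (\<lambda>j. (\<pi> j \<Zsemi> \<iota> j) \<Zsemi> h) J"
      by (rule hsum_comp) (use b assms(2) S h in \<open>auto intro: comp_hom\<close>)
    also have "\<dots> = hsum L S A (\<lambda>j. \<pi> j \<Zsemi> (\<iota> j \<Zsemi> h)) J"
      by (rule hsum_cong)
        (use b A S h comp_assoc[OF _ _ h] in \<open>auto intro: comp_hom\<close>, metis)
    finally show ?thesis .
  qed
  have "hsum L S A (\<lambda>j. \<pi> j \<Zsemi> (\<iota> j \<Zsemi> f)) J = hsum L S A (\<lambda>j. \<pi> j \<Zsemi> (\<iota> j \<Zsemi> g)) J"
    by (rule hsum_cong) (use b A S assms in \<open>auto intro: comp_hom\<close>)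
  then show ?thesis using expand assms(3,4) by metis
qed

lemma finite_biproduct:
  assumes "has_finite_biproducts L P" "finite J" "\<And>j. j \<in> J \<Longrightarrow> X j \<in> Obj L"
  shows "biproduct L J X (bsum P J X) (bproj P J X) (binj P J X)"
  using assms unfolding has_finite_biproducts_def by blast

section \<open>The biproduct as a functor on families of arrows\<close>

lemma bmap_Hom:
  assumes "has_finite_biproducts L P" "finite J" "\<And>j. j \<in> J \<Longrightarrow> f j \<in> Hom L (X j) (Y j)"
  shows "bmap L P J X Y f \<in> Hom L (bsum P J X) (bsum P J Y)"
proof -
  have b: "biproduct L J X (bsum P J X) (bproj P J X) (binj P J X)"
    "biproduct L J Y (bsum P J Y) (bproj P J Y) (binj P J Y)"
    using assms by (auto intro!: finite_biproduct dest: Hom_Obj)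
  show ?thesis unfolding bmap_def
  proof (rule hsum_Hom)
    show "bsum P J X \<in> Obj L" "bsum P J Y \<in> Obj L"
      using b by (simp_all add: biproduct_def)
    show "bproj P J X j \<Zsemi> f j \<Zsemi> binj P J Y j \<in> Hom L (bsum P J X) (bsum P J Y)" if "j \<in> J" for j
      using comp_hom[OF comp_hom[OF biproduct_Hom(1)[OF b(1)] assms(3)] biproduct_Hom(2)[OF b(2)]]
        that by blast
  qed
qed

lemma bmap_proj:
  assumes "has_finite_biproducts L P" "finite J" "\<And>j. j \<in> J \<Longrightarrow> f j \<in> Hom L (X j) (Y j)" "j \<in> J"
  shows "bmap L P J X Y f \<Zsemi> bproj P J Y j = bproj P J X j \<Zsemi> f j"
proof -
  have b: "biproduct L J X (bsum P J X) (bproj P J X) (binj P J X)"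
    "biproduct L J Y (bsum P J Y) (bproj P J Y) (binj P J Y)"
    using assms by (auto intro!: finite_biproduct dest: Hom_Obj)
  show ?thesis unfolding bmap_def
    by (rule biproduct_pair_proj[OF b(2)])
      (use assms in \<open>auto intro: comp_hom[OF biproduct_Hom(1)[OF b(1)] assms(3)]\<close>)
qed

text \<open>Reduces functoriality to comparing projections: identities and composites only have to
  satisfy the equation that characterises \<open>bmap\<close>.\<close>

lemma bmap_unique:
  assumes "has_finite_biproducts L P" "finite J" "\<And>j. j \<in> J \<Longrightarrow> f j \<in> Hom L (X j) (Y j)"
    "h \<in> Hom L (bsum P J X) (bsum P J Y)"
    "\<And>j. j \<in> J \<Longrightarrow> h \<Zsemi> bproj P J Y j = bproj P J X j \<Zsemi> f j"
  shows "bmap L P J X Y f = h"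
proof -
  have "biproduct L J Y (bsum P J Y) (bproj P J Y) (binj P J Y)"
    using assms by (auto intro!: finite_biproduct dest: Hom_Obj)
  then show ?thesis
    by (rule biproduct_proj_eqI[OF _ assms(2)]) (use assms in \<open>auto simp: bmap_Hom bmap_proj\<close>)
qed

lemma bmap_Ide:
  assumes P: "has_finite_biproducts L P" and J: "finite J" and X: "\<And>j. j \<in> J \<Longrightarrow> X j \<in> Obj L"
    and f: "\<And>j. j \<in> J \<Longrightarrow> f j = Ide L (X j)"
  shows "bmap L P J X X f = Ide L (bsum P J X)"
proof -
  have b: "biproduct L J X (bsum P J X) (bproj P J X) (binj P J X)"
    using assms by (auto intro!: finite_biproduct)
  note h = biproduct_Hom(1)[OF b]
  show ?thesis
    by (rule bmap_unique[OF P J])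
      (use b X f ide_comp[OF h] comp_ide[OF h] in \<open>auto simp: ide_hom biproduct_def\<close>)
qed

text \<open>The composite family is a separate \<open>k\<close>, tied to
  \<open>f j \<Zsemi> g j\<close> only on \<open>J\<close>, so that the rule also applies to
  families written with \<open>two\<close> or with a case distinction on pairs.\<close>

lemma bmap_comp:
  assumes P: "has_finite_biproducts L P" and J: "finite J"
    and f: "\<And>j. j \<in> J \<Longrightarrow> f j \<in> Hom L (X j) (Y j)"
    and g: "\<And>j. j \<in> J \<Longrightarrow> g j \<in> Hom L (Y j) (W j)"
    and k: "\<And>j. j \<in> J \<Longrightarrow> k j = f j \<Zsemi> g j"
  shows "bmap L P J X W k = bmap L P J X Y f \<Zsemi> bmap L P J Y W g"
proof (rule bmap_unique[OF P J])
  have b: "biproduct L J X (bsum P J X) (bproj P J X) (binj P J X)"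
    "biproduct L J Y (bsum P J Y) (bproj P J Y) (binj P J Y)"
    "biproduct L J W (bsum P J W) (bproj P J W) (binj P J W)"
    using P J f g by (auto intro!: finite_biproduct dest: Hom_Obj)
  have F: "bmap L P J X Y f \<in> Hom L (bsum P J X) (bsum P J Y)"
    and G: "bmap L P J Y W g \<in> Hom L (bsum P J Y) (bsum P J W)"
    using P J f g by (auto intro: bmap_Hom)
  show "bmap L P J X Y f \<Zsemi> bmap L P J Y W g \<in> Hom L (bsum P J X) (bsum P J W)"
    using F G by (rule comp_hom)
  show "k j \<in> Hom L (X j) (W j)" if "j \<in> J" for j
    using comp_hom[OF f g] that k by auto
  show "(bmap L P J X Y f \<Zsemi> bmap L P J Y W g) \<Zsemi> bproj P J W j = bproj P J X j \<Zsemi> k j"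
    if j: "j \<in> J" for j
  proof -
    note p = biproduct_Hom(1)[OF b(1) j] biproduct_Hom(1)[OF b(2) j] biproduct_Hom(1)[OF b(3) j]
    have "(bmap L P J X Y f \<Zsemi> bmap L P J Y W g) \<Zsemi> bproj P J W j =
        bmap L P J X Y f \<Zsemi> (bproj P J Y j \<Zsemi> g j)"
      using comp_assoc[OF F G p(3)] bmap_proj[OF P J g j] by simp
    also have "\<dots> = (bproj P J X j \<Zsemi> f j) \<Zsemi> g j"
      using comp_assoc[OF F p(2) g[OF j]] bmap_proj[OF P J f j] by simp
    finally show ?thesis using comp_assoc[OF p(1) f[OF j] g[OF j]] k[OF j] by simp
  qed
qed

section \<open>Binary biproducts\<close>

lemma biproduct2:
  assumes "has_finite_biproducts L P" "A \<in> Obj L" "B \<in> Obj L"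
  shows "biproduct L {0, 1} (two A B) (bsum2 P A B) (bproj2 P A B) (binj2 P A B)"
  unfolding bsum2_def bproj2_def binj2_def
  by (rule finite_biproduct) (use assms in \<open>auto simp: two_def\<close>)

lemma biproduct2_Hom:
  assumes "has_finite_biproducts L P" "A \<in> Obj L" "B \<in> Obj L"
  shows "bproj2 P A B 0 \<in> Hom L (bsum2 P A B) A" "bproj2 P A B 1 \<in> Hom L (bsum2 P A B) B"
    "binj2 P A B 0 \<in> Hom L A (bsum2 P A B)" "binj2 P A B 1 \<in> Hom L B (bsum2 P A B)"
    "bsum2 P A B \<in> Obj L"
  using biproduct_Hom[OF biproduct2[OF assms], of 0] biproduct_Hom[OF biproduct2[OF assms], of 1]
  by (simp_all add: two_def)

lemma biproduct2_inj_proj: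
  assumes "has_finite_biproducts L P" "A \<in> Obj L" "B \<in> Obj L"
  shows "binj2 P A B 0 \<Zsemi> bproj2 P A B 0 = Ide L A" "binj2 P A B 1 \<Zsemi> bproj2 P A B 1 = Ide L B"
    "binj2 P A B 0 \<Zsemi> bproj2 P A B 1 = hzero L A B" "binj2 P A B 1 \<Zsemi> bproj2 P A B 0 = hzero L B A"
  using biproduct2[OF assms] by (simp_all add: biproduct_def two_def)

text \<open>Turns the indexed decomposition of the identity into a binary \<open>+\<^sub>m\<close>,
  the shape to which \<open>bang_add\<close> applies.\<close>

lemma biproduct2_sum:
  assumes "has_finite_biproducts L P" "A \<in> Obj L" "B \<in> Obj L"
  shows "(bproj2 P A B 0 \<Zsemi> binj2 P A B 0) +\<^sub>m (bproj2 P A B 1 \<Zsemi> binj2 P A B 1) =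
    Ide L (bsum2 P A B)"
proof -
  let ?S = "bsum2 P A B" and ?F = "\<lambda>j. bproj2 P A B j \<Zsemi> binj2 P A B j"
  note h = biproduct2_Hom[OF assms]
  have F: "?F 0 \<in> Hom L ?S ?S" "?F 1 \<in> Hom L ?S ?S"
    using h by (auto intro: comp_hom)
  have "hsum L ?S ?S ?F {0, 1} = ?F 0 +\<^sub>m hsum L ?S ?S ?F {1}"
    by (rule hsum_insert) (use F h in auto)
  also have "hsum L ?S ?S ?F {1} = ?F 1"
    by (rule hsum_single) (use F in auto)
  finally show ?thesis using biproduct2[OF assms] by (simp add: biproduct_def)
qed

lemma bmap2:
  assumes P: "has_finite_biproducts L P" and f: "f \<in> Hom L A B" and g: "g \<in> Hom L C D"
  shows bmap2_Hom: "bmap2 L P f g \<in> Hom L (bsum2 P A C) (bsum2 P B D)"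
    and bmap2_proj: "bmap2 L P f g \<Zsemi> bproj2 P B D 0 = bproj2 P A C 0 \<Zsemi> f"
      "bmap2 L P f g \<Zsemi> bproj2 P B D 1 = bproj2 P A C 1 \<Zsemi> g"
proof -
  have t: "two f g j \<in> Hom L (two A C j) (two B D j)" for j
    using f g by (simp add: two_def)
  \<comment> \<open>\<open>bmap2\<close> reads the endpoints of its arguments through
    \<open>Dom\<close> and \<open>Cod\<close>; these equations replace them by the given
    objects.\<close>
  have d: "Dom L f = A" "Dom L g = C" "Cod L f = B" "Cod L g = D"
    using f g by (auto simp: Hom_iff)
  show "bmap2 L P f g \<in> Hom L (bsum2 P A C) (bsum2 P B D)"
    using t bmap_Hom[OF P, of "{0, 1}" "two f g" "two A C" "two B D"] by (simp add: bmap2_def bsum2_def d)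
  show "bmap2 L P f g \<Zsemi> bproj2 P B D 0 = bproj2 P A C 0 \<Zsemi> f"
    "bmap2 L P f g \<Zsemi> bproj2 P B D 1 = bproj2 P A C 1 \<Zsemi> g"
    using t bmap_proj[OF P, of "{0, 1}" "two f g" "two A C" "two B D" 0]
      bmap_proj[OF P, of "{0, 1}" "two f g" "two A C" "two B D" 1]
    by (simp_all add: bmap2_def bproj2_def d two_def[of f g])
qed

lemma bmap2_Ide:
  assumes "has_finite_biproducts L P" "A \<in> Obj L" "B \<in> Obj L"
  shows "bmap2 L P (Ide L A) (Ide L B) = Ide L (bsum2 P A B)"
  unfolding bmap2_def bsum2_def
  using bmap_Ide[OF assms(1), of "{0, 1}" "two A B"] assms by (simp add: Ide_Arr two_def)

lemma bmap2_comp: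
  assumes "has_finite_biproducts L P" "f \<in> Hom L A B" "f' \<in> Hom L B C"
    "g \<in> Hom L A' B'" "g' \<in> Hom L B' C'"
  shows "bmap2 L P (f \<Zsemi> f') (g \<Zsemi> g') = bmap2 L P f g \<Zsemi> bmap2 L P f' g'"
proof -
  have d: "Dom L f = A" "Dom L g = A'" "Cod L f = B" "Cod L g = B'"
    "Dom L f' = B" "Dom L g' = B'" "Cod L f' = C" "Cod L g' = C'"
    "Dom L (f \<Zsemi> f') = A" "Cod L (f \<Zsemi> f') = C" "Dom L (g \<Zsemi> g') = A'" "Cod L (g \<Zsemi> g') = C'"
    using assms by (auto simp: Hom_iff comp_Arr)
  show ?thesis unfolding bmap2_def d
    by (rule bmap_comp[OF assms(1)]) (use assms in \<open>auto simp: two_def\<close>)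
qed

end

section \<open>Graded bialgebra modalities\<close>

lemma finite_split_pairs: "finite (splits (r :: 'r :: fas_semiring))"
  by (simp add: splits_def finite_splits)

text \<open>The first two equations already place \<open>(a, b)\<close> and \<open>(c, d)\<close> in
  the finite sets of splittings of \<open>r\<close> and \<open>s\<close>. This makes the bimonoid
  sum a genuine finite sum.\<close>

lemma finite_splits_quadruples:
  "finite {(a, b, c, d). a + b = (r :: 'r :: fas_semiring) \<and> c + d = s \<and> a + c = t \<and> b + d = u}"
  by (rule finite_subset[of _ "(\<lambda>((a, b), (c, d)). (a, b, c, d)) ` (splits r \<times> splits s)"])
    (auto simp: finite_split_pairs intro!: finite_imageI, auto simp: splits_def image_iff)

section \<open>Typing and naturality of the structure maps, then the bimonoid law\<close>

context graded_additive_bialgebra_modality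
begin

lemma bang_Obj: "A \<in> Obj L \<Longrightarrow> bang_ob M r A \<in> Obj L"
  using bang_functor by (auto simp: is_functor_def)

lemma bang_Arr:
  assumes "f \<in> Arr L"
  shows "bang_arr M r f \<in> Arr L" "Dom L (bang_arr M r f) = bang_ob M r (Dom L f)"
    "Cod L (bang_arr M r f) = bang_ob M r (Cod L f)"
  using bang_functor assms by (auto simp: is_functor_def Hom_def)

lemma bang_Ide: "A \<in> Obj L \<Longrightarrow> bang_arr M r (Ide L A) = Ide L (bang_ob M r A)"
  using bang_functor by (auto simp: is_functor_def)

lemma bang_comp:
  "f \<in> Arr L \<Longrightarrow> g \<in> Arr L \<Longrightarrow> Cod L f = Dom L g \<Longrightarrow>
    bang_arr M r f \<Zsemi> bang_arr M r g = bang_arr M r (f \<Zsemi> g)"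
  using bang_functor by (auto simp: is_functor_def Hom_def)

lemma contraction_Arr:
  assumes "A \<in> Obj L"
  shows "contraction M r s A \<in> Arr L" "Dom L (contraction M r s A) = bang_ob M (r + s) A"
    "Cod L (contraction M r s A) = bang_ob M r A \<otimes>\<^sub>o bang_ob M s A"
  using contraction_natural assms by (auto simp: natural_transformation_def Hom_def)

lemma cocontraction_Arr:
  assumes "A \<in> Obj L"
  shows "cocontraction M r s A \<in> Arr L" "Cod L (cocontraction M r s A) = bang_ob M (r + s) A"
    "Dom L (cocontraction M r s A) = bang_ob M r A \<otimes>\<^sub>o bang_ob M s A"
  using cocontraction_natural assms by (auto simp: natural_transformation_def Hom_def)

lemma weakening_Arr:
  assumes "A \<in> Obj L"
  shows "weakening M A \<in> Arr L" "Dom L (weakening M A) = bang_ob M 0 A"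
    "Cod L (weakening M A) = \<I>"
  using weakening_natural assms by (auto simp: natural_transformation_def Hom_def)

lemma coweakening_Arr:
  assumes "A \<in> Obj L"
  shows "coweakening M A \<in> Arr L" "Dom L (coweakening M A) = \<I>"
    "Cod L (coweakening M A) = bang_ob M 0 A"
  using coweakening_natural assms by (auto simp: natural_transformation_def Hom_def)

lemma contraction_naturality:
  "f \<in> Arr L \<Longrightarrow> bang_arr M (r + s) f \<Zsemi> contraction M r s (Cod L f) =
    contraction M r s (Dom L f) \<Zsemi> (bang_arr M r f \<otimes>\<^sub>m bang_arr M s f)"
  using contraction_natural[of r s] by (auto simp: natural_transformation_def Hom_def)

lemma cocontraction_naturality:
  "f \<in> Arr L \<Longrightarrow> (bang_arr M r f \<otimes>\<^sub>m bang_arr M s f) \<Zsemi> cocontraction M r s (Cod L f) =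
    cocontraction M r s (Dom L f) \<Zsemi> bang_arr M (r + s) f"
  using cocontraction_natural[of r s] by (auto simp: natural_transformation_def Hom_def)

lemmas mod_simps = mon_simps bang_Obj bang_Arr bang_Ide contraction_Arr cocontraction_Arr
  weakening_Arr coweakening_Arr

text \<open>Concerns a single summand of the bimonoid law. Naturality pushes \<open>f\<close> and
  \<open>g\<close> past the contractions and the symmetry, and pulls \<open>h\<close> and
  \<open>k\<close> back past the cocontractions. The arrows meet in the middle, with
  \<open>g \<Zsemi> h\<close> at grade \<open>c\<close> and \<open>f \<Zsemi> k\<close> at grade
  \<open>b\<close>, the two grades that cross.\<close>

lemma bimonoid_term_naturality:
  assumes f: "f \<in> Hom L A C" and g: "g \<in> Hom L B C"
    and h: "h \<in> Hom L C A'" and k: "k \<in> Hom L C B'"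
  shows "(bang_arr M (a + b) f \<otimes>\<^sub>m bang_arr M (c + d) g) \<Zsemi>
      (((contraction M a b C \<otimes>\<^sub>m contraction M c d C) \<Zsemi>
        (Ide L (bang_ob M a C) \<otimes>\<^sub>m symm L (bang_ob M b C) (bang_ob M c C)
           \<otimes>\<^sub>m Ide L (bang_ob M d C)) \<Zsemi>
        (cocontraction M a c C \<otimes>\<^sub>m cocontraction M b d C)) \<Zsemi>
       (bang_arr M (a + c) h \<otimes>\<^sub>m bang_arr M (b + d) k)) =
    (contraction M a b A \<otimes>\<^sub>m contraction M c d B) \<Zsemi>
    ((Ide L (bang_ob M a A) \<otimes>\<^sub>m symm L (bang_ob M b A) (bang_ob M c B)
       \<otimes>\<^sub>m Ide L (bang_ob M d B)) \<Zsemi>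
     (((bang_arr M a (f \<Zsemi> h) \<otimes>\<^sub>m bang_arr M c (g \<Zsemi> h)) \<Zsemi> cocontraction M a c A') \<otimes>\<^sub>m
      ((bang_arr M b (f \<Zsemi> k) \<otimes>\<^sub>m bang_arr M d (g \<Zsemi> k)) \<Zsemi> cocontraction M b d B')))"
    (is "?x \<Zsemi> ((?c2 \<Zsemi> ?m \<Zsemi> ?n) \<Zsemi> ?y) = ?c \<Zsemi> (?m' \<Zsemi> ?e)")
proof -
  have o: "A \<in> Obj L" "B \<in> Obj L" "C \<in> Obj L" "A' \<in> Obj L" "B' \<in> Obj L"
    using Hom_Obj assms by auto
  have arr: "f \<in> Arr L" "Dom L f = A" "Cod L f = C" "g \<in> Arr L" "Dom L g = B" "Cod L g = C"
    "h \<in> Arr L" "Dom L h = C" "Cod L h = A'" "k \<in> Arr L" "Dom L k = C" "Cod L k = B'"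
    using assms by (auto simp: Hom_iff)
  note sms = mod_simps o arr
  let ?F = "(bang_arr M a f \<otimes>\<^sub>m bang_arr M b f) \<otimes>\<^sub>m (bang_arr M c g \<otimes>\<^sub>m bang_arr M d g)"
  let ?F' = "(bang_arr M a f \<otimes>\<^sub>m bang_arr M c g) \<otimes>\<^sub>m (bang_arr M b f \<otimes>\<^sub>m bang_arr M d g)"
  let ?H = "(bang_arr M a h \<otimes>\<^sub>m bang_arr M c h) \<otimes>\<^sub>m (bang_arr M b k \<otimes>\<^sub>m bang_arr M d k)"
  let ?n' = "cocontraction M a c A' \<otimes>\<^sub>m cocontraction M b d B'"
  have 1: "?x \<Zsemi> ?c2 = ?c \<Zsemi> ?F"
    using contraction_naturality[of f a b] contraction_naturality[of g c d]
    by (simp add: interchange sms)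
  have 2: "?n \<Zsemi> ?y = ?H \<Zsemi> ?n'"
    using cocontraction_naturality[of h a c] cocontraction_naturality[of k b d]
    by (simp add: interchange sms)
  have 3: "?F \<Zsemi> ?m = ?m' \<Zsemi> ?F'"
    using middle_symm_naturality[of "bang_arr M a f" "bang_arr M b f" "bang_arr M c g" "bang_arr M d g"]
    by (simp add: sms)
  \<comment> \<open>Reassociating to the left puts \<open>?F'\<close> next to \<open>?H\<close>,
    where interchange and functoriality of each \<open>bang_arr\<close> merge them.\<close>
  have 4: "?F' \<Zsemi> (?H \<Zsemi> ?n') = ?e"
    by (simp add: interchange bang_comp sms flip: comp_assoc_Arr)
  \<comment> \<open>The middle symmetries fit their neighbours only after objects are rebracketed,
    so their endpoints are recorded once for the associativity steps below.\<close>
  have m: "?m \<in> Arr L" "Dom L ?m = Cod L ?c2" "Cod L ?m = Dom L ?n"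
    "?m' \<in> Arr L" "Dom L ?m' = Cod L ?c" "Cod L ?m' = Dom L ?F'"
    by (simp_all add: sms tensor_ob_assoc)
  have "?x \<Zsemi> ((?c2 \<Zsemi> ?m \<Zsemi> ?n) \<Zsemi> ?y) = (?x \<Zsemi> ?c2) \<Zsemi> (?m \<Zsemi> (?n \<Zsemi> ?y))"
    by (simp add: comp_assoc_Arr sms m)
  also have "\<dots> = ?c \<Zsemi> ((?F \<Zsemi> ?m) \<Zsemi> (?H \<Zsemi> ?n'))"
    unfolding 1 2 by (simp add: comp_assoc_Arr sms m)
  also have "\<dots> = ?c \<Zsemi> (?m' \<Zsemi> (?F' \<Zsemi> (?H \<Zsemi> ?n')))"
    unfolding 3 by (simp add: comp_assoc_Arr sms m)
  finally show ?thesis unfolding 4 .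
qed

text \<open>\<open>weakening M B \<Zsemi> coweakening M A\<close> is the value of \<open>!_0\<close>
  at a zero arrow. Interchange splits off its coweakening, which the unit law of cocontraction
  absorbs.\<close>

lemma cocontraction_weak_right:
  assumes "p \<in> Hom L X (bang_ob M r A)" "B \<in> Obj L" "A \<in> Obj L"
  shows "(p \<otimes>\<^sub>m (weakening M B \<Zsemi> coweakening M A)) \<Zsemi> cocontraction M r 0 A =
    p \<otimes>\<^sub>m weakening M B"
proof -
  have p: "p \<in> Arr L" "Dom L p = X" "Cod L p = bang_ob M r A" "X \<in> Obj L"
    using assms Hom_Obj by (auto simp: Hom_iff)
  have "p \<otimes>\<^sub>m (weakening M B \<Zsemi> coweakening M A) =
      (p \<otimes>\<^sub>m weakening M B) \<Zsemi> (Ide L (bang_ob M r A) \<otimes>\<^sub>m coweakening M A)"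
    using assms p by (simp add: interchange mod_simps)
  then show ?thesis
    using assms p by (simp add: comp_assoc_Arr cocontraction_unit mod_simps)
qed

lemma cocontraction_weak_left:
  assumes "q \<in> Hom L X (bang_ob M s B)" "A \<in> Obj L" "B \<in> Obj L"
  shows "((weakening M A \<Zsemi> coweakening M B) \<otimes>\<^sub>m q) \<Zsemi> cocontraction M 0 s B =
    weakening M A \<otimes>\<^sub>m q"
proof -
  have q: "q \<in> Arr L" "Dom L q = X" "Cod L q = bang_ob M s B" "X \<in> Obj L"
    using assms Hom_Obj by (auto simp: Hom_iff)
  have "(weakening M A \<Zsemi> coweakening M B) \<otimes>\<^sub>m q =
      (weakening M A \<otimes>\<^sub>m q) \<Zsemi> (coweakening M B \<otimes>\<^sub>m Ide L (bang_ob M s B))"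
    using assms q by (simp add: interchange mod_simps)
  then show ?thesis
    using assms q by (simp add: comp_assoc_Arr cocontraction_unit mod_simps)
qed

text \<open>Interchange isolates the weakening, and the counit law of contraction then cancels
  it.\<close>

lemma contraction_weak_right:
  assumes "p \<in> Hom L (bang_ob M r A) X" "A \<in> Obj L"
  shows "contraction M r 0 A \<Zsemi> (p \<otimes>\<^sub>m weakening M A) = p"
proof -
  have p: "p \<in> Arr L" "Dom L p = bang_ob M r A" "Cod L p = X" "X \<in> Obj L"
    using assms Hom_Obj by (auto simp: Hom_iff)
  \<comment> \<open>By strict unitality \<open>p\<close> equals its tensor with the identity of
    \<open>\<I>\<close>, so the right-hand side is a composite of two tensors and interchange
    applies.\<close>
  have "p \<otimes>\<^sub>m weakening M A = (Ide L (bang_ob M r A) \<otimes>\<^sub>m weakening M A) \<Zsemi> (p \<otimes>\<^sub>m Ide L \<I>)"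
    using assms p by (simp add: interchange mod_simps del: tensor_arr_unit)
  then have "p \<otimes>\<^sub>m weakening M A = (Ide L (bang_ob M r A) \<otimes>\<^sub>m weakening M A) \<Zsemi> p"
    using p by (simp add: tensor_arr_unit)
  then show ?thesis
    using assms p by (simp add: contraction_counit mod_simps flip: comp_assoc_Arr)
qed

lemma contraction_weak_left:
  assumes "q \<in> Hom L (bang_ob M s B) X" "B \<in> Obj L"
  shows "contraction M 0 s B \<Zsemi> (weakening M B \<otimes>\<^sub>m q) = q"
proof -
  have q: "q \<in> Arr L" "Dom L q = bang_ob M s B" "Cod L q = X" "X \<in> Obj L"
    using assms Hom_Obj by (auto simp: Hom_iff)
  have "weakening M B \<otimes>\<^sub>m q = (weakening M B \<otimes>\<^sub>m Ide L (bang_ob M s B)) \<Zsemi> (Ide L \<I> \<otimes>\<^sub>m q)"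
    using assms q by (simp add: interchange mod_simps del: tensor_arr_unit)
  then have "weakening M B \<otimes>\<^sub>m q = (weakening M B \<otimes>\<^sub>m Ide L (bang_ob M s B)) \<Zsemi> q"
    using q by (simp add: tensor_arr_unit)
  then show ?thesis
    using assms q by (simp add: contraction_counit mod_simps flip: comp_assoc_Arr)
qed

text \<open>This is the summand with crossing grades \<open>b = c = 0\<close>. The unit laws remove
  the coweakenings; the remaining weakenings slide through the symmetry, which becomes
  \<open>symm L \<I> \<I>\<close>, an identity; the counit laws then remove the
  contractions.\<close>

lemma bimonoid_diagonal_term:
  assumes p: "p \<in> Hom L (bang_ob M r A) (bang_ob M r A')"
    and q: "q \<in> Hom L (bang_ob M s B) (bang_ob M s B')"
    and o: "A \<in> Obj L" "A' \<in> Obj L" "B \<in> Obj L" "B' \<in> Obj L"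
  shows "(contraction M r 0 A \<otimes>\<^sub>m contraction M 0 s B) \<Zsemi>
    ((Ide L (bang_ob M r A) \<otimes>\<^sub>m symm L (bang_ob M 0 A) (bang_ob M 0 B)
       \<otimes>\<^sub>m Ide L (bang_ob M s B)) \<Zsemi>
     (((p \<otimes>\<^sub>m (weakening M B \<Zsemi> coweakening M A')) \<Zsemi> cocontraction M r 0 A') \<otimes>\<^sub>m
      (((weakening M A \<Zsemi> coweakening M B') \<otimes>\<^sub>m q) \<Zsemi> cocontraction M 0 s B'))) = p \<otimes>\<^sub>m q"
    (is "?c \<Zsemi> (?m \<Zsemi> ?e) = _")
proof -
  have arr: "p \<in> Arr L" "Dom L p = bang_ob M r A" "Cod L p = bang_ob M r A'"
    "q \<in> Arr L" "Dom L q = bang_ob M s B" "Cod L q = bang_ob M s B'"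
    using p q by (auto simp: Hom_iff)
  note sms = mod_simps o arr
  have "?e = (p \<otimes>\<^sub>m weakening M B) \<otimes>\<^sub>m (weakening M A \<otimes>\<^sub>m q)"
    using p q o by (simp add: cocontraction_weak_right cocontraction_weak_left)
  then have "?m \<Zsemi> ?e = (p \<otimes>\<^sub>m weakening M A) \<otimes>\<^sub>m (weakening M B \<otimes>\<^sub>m q)"
    using middle_symm_naturality[of p "weakening M A" "weakening M B" q]
    by (simp add: sms symm_unit)
  then show ?thesis
    using p q o by (simp add: interchange sms contraction_weak_right contraction_weak_left)
qed

text \<open>The zero composites kill every summand of the bimonoid law in which a nonzero grade crosses
  the symmetry; the remaining one has \<open>b = c = 0\<close>, which forces \<open>(r, s) = (t, u)\<close>.\<close>

lemma cocontraction_contraction_orthogonal: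
  assumes f: "f \<in> Hom L A C" and g: "g \<in> Hom L B C"
    and h: "h \<in> Hom L C A'" and k: "k \<in> Hom L C B'"
    and fk: "f \<Zsemi> k = hzero L A B'" and gh: "g \<Zsemi> h = hzero L B A'"
    and rs: "r + s = t + u"
  shows "((bang_arr M r f \<otimes>\<^sub>m bang_arr M s g) \<Zsemi> cocontraction M r s C) \<Zsemi>
      (contraction M t u C \<Zsemi> (bang_arr M t h \<otimes>\<^sub>m bang_arr M u k)) =
    (if (r, s) = (t, u) then bang_arr M r (f \<Zsemi> h) \<otimes>\<^sub>m bang_arr M s (g \<Zsemi> k)
     else hzero L (bang_ob M r A \<otimes>\<^sub>o bang_ob M s B) (bang_ob M t A' \<otimes>\<^sub>o bang_ob M u B'))"
    (is "?lhs = (if _ then ?diag else ?zero)")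
proof -
  have o: "A \<in> Obj L" "B \<in> Obj L" "C \<in> Obj L" "A' \<in> Obj L" "B' \<in> Obj L"
    using Hom_Obj assms by auto
  have arr: "f \<in> Arr L" "Dom L f = A" "Cod L f = C" "g \<in> Arr L" "Dom L g = B" "Cod L g = C"
    "h \<in> Arr L" "Dom L h = C" "Cod L h = A'" "k \<in> Arr L" "Dom L k = C" "Cod L k = B'"
    using f g h k by (auto simp: Hom_iff)
  note sms = mod_simps o arr
  define J where "J = {(a, b, c, d). a + b = r \<and> c + d = s \<and> a + c = t \<and> b + d = u}"
  have fin: "finite J" unfolding J_def by (rule finite_splits_quadruples)
  let ?x = "bang_arr M r f \<otimes>\<^sub>m bang_arr M s g"
  let ?y = "bang_arr M t h \<otimes>\<^sub>m bang_arr M u k"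
  let ?X = "bang_ob M r A \<otimes>\<^sub>o bang_ob M s B"
  let ?Y = "bang_ob M t A' \<otimes>\<^sub>o bang_ob M u B'"
  let ?R = "bang_ob M r C \<otimes>\<^sub>o bang_ob M s C"
  let ?T = "bang_ob M t C \<otimes>\<^sub>o bang_ob M u C"
  define F where "F = (\<lambda>(a, b, c, d).
           (contraction M a b C \<otimes>\<^sub>m contraction M c d C) \<Zsemi>
           (Ide L (bang_ob M a C) \<otimes>\<^sub>m symm L (bang_ob M b C) (bang_ob M c C)
              \<otimes>\<^sub>m Ide L (bang_ob M d C)) \<Zsemi>
           (cocontraction M a c C \<otimes>\<^sub>m cocontraction M b d C))"
  \<comment> \<open>The summand \<open>F\<close> after the outer arrows have been moved inside by
    \<open>bimonoid_term_naturality\<close>.\<close>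
  define T where "T = (\<lambda>(a, b, c, d).
    (contraction M a b A \<otimes>\<^sub>m contraction M c d B) \<Zsemi>
    ((Ide L (bang_ob M a A) \<otimes>\<^sub>m symm L (bang_ob M b A) (bang_ob M c B)
       \<otimes>\<^sub>m Ide L (bang_ob M d B)) \<Zsemi>
     (((bang_arr M a (f \<Zsemi> h) \<otimes>\<^sub>m bang_arr M c (g \<Zsemi> h)) \<Zsemi> cocontraction M a c A') \<otimes>\<^sub>m
      ((bang_arr M b (f \<Zsemi> k) \<otimes>\<^sub>m bang_arr M d (g \<Zsemi> k)) \<Zsemi> cocontraction M b d B'))))"
  have F: "F j \<in> Hom L ?R ?T" if "j \<in> J" for j
    using that by (auto simp: J_def F_def Hom_iff sms tensor_ob_assoc)
  have x: "?x \<in> Hom L ?X ?R" and y: "?y \<in> Hom L ?T ?Y"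
    by (auto simp: Hom_iff sms)
  have XY: "?X \<in> Obj L" "?Y \<in> Obj L" "?R \<in> Obj L" "?T \<in> Obj L" by (simp_all add: sms)
  have eq: "?x \<Zsemi> (F j \<Zsemi> ?y) = T j" if "j \<in> J" for j
    using that bimonoid_term_naturality[OF f g h k] by (auto simp: J_def F_def T_def)
  have cc: "cocontraction M r s C \<Zsemi> contraction M t u C = hsum L ?R ?T F J"
    unfolding F_def J_def by (rule cocontraction_contraction[OF o(3) rs])
  have Hfk: "hzero L A B' \<in> Arr L" "Dom L (hzero L A B') = A" "Cod L (hzero L A B') = B'"
    and Hgh: "hzero L B A' \<in> Arr L" "Dom L (hzero L B A') = B" "Cod L (hzero L B A') = A'"
    using hzero_Hom[OF o(1,5)] hzero_Hom[OF o(2,4)] by (auto simp: Hom_iff)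
  have vanish: "T (a, b, c, d) = ?zero" if J: "(a, b, c, d) \<in> J" and ne: "b \<noteq> 0 \<or> c \<noteq> 0" for a b c d
  proof -
    let ?e1 = "(bang_arr M a (f \<Zsemi> h) \<otimes>\<^sub>m bang_arr M c (g \<Zsemi> h)) \<Zsemi> cocontraction M a c A'"
    let ?e2 = "(bang_arr M b (f \<Zsemi> k) \<otimes>\<^sub>m bang_arr M d (g \<Zsemi> k)) \<Zsemi> cocontraction M b d B'"
    let ?E1 = "bang_ob M a A \<otimes>\<^sub>o bang_ob M c B" and ?E2 = "bang_ob M b A \<otimes>\<^sub>o bang_ob M d B"
    have E1: "?e1 \<in> Hom L ?E1 (bang_ob M t A')" and E2: "?e2 \<in> Hom L ?E2 (bang_ob M u B')"
      using J by (auto simp: J_def Hom_iff sms fk gh Hfk Hgh)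
    have co: "cocontraction M a c A' \<in> Hom L (bang_ob M a A' \<otimes>\<^sub>o bang_ob M c A') (bang_ob M t A')"
      "cocontraction M b d B' \<in> Hom L (bang_ob M b B' \<otimes>\<^sub>o bang_ob M d B') (bang_ob M u B')"
      using J by (auto simp: J_def Hom_iff sms)
    have fh: "bang_arr M a (f \<Zsemi> h) \<in> Hom L (bang_ob M a A) (bang_ob M a A')"
      and gk: "bang_arr M d (g \<Zsemi> k) \<in> Hom L (bang_ob M d B) (bang_ob M d B')"
      by (auto simp: Hom_iff sms)
    have "?e1 \<otimes>\<^sub>m ?e2 = hzero L (?E1 \<otimes>\<^sub>o ?E2) ?Y"
    \<comment> \<open>For \<open>c \<noteq> 0\<close> the left factor contains \<open>!_c\<close> of
      the zero arrow \<open>g \<Zsemi> h\<close>. Otherwise \<open>b \<noteq> 0\<close>, and the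
      right factor contains \<open>!_b\<close> of the zero arrow \<open>f \<Zsemi> k\<close>. Either
      one makes the whole tensor zero.\<close>
    proof (cases "c = 0")
      case False
      then have "?e1 = hzero L ?E1 (bang_ob M t A')"
        using tensor_zero[OF fh] zero_comp[OF _ co(1)] by (simp add: gh bang_zero sms)
      then show ?thesis using zero_tensor[OF _ _ E2] by (simp add: sms)
    next
      case True
      then have "?e2 = hzero L ?E2 (bang_ob M u B')"
        using ne zero_tensor[OF _ _ gk] zero_comp[OF _ co(2)] by (simp add: fk bang_zero sms)
      then show ?thesis using tensor_zero[OF E1] by (simp add: sms)
    qed
    then have "T (a, b, c, d) = (contraction M a b A \<otimes>\<^sub>m contraction M c d B) \<Zsemi>
      ((Ide L (bang_ob M a A) \<otimes>\<^sub>m symm L (bang_ob M b A) (bang_ob M c B)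
       \<otimes>\<^sub>m Ide L (bang_ob M d B)) \<Zsemi> hzero L (?E1 \<otimes>\<^sub>o ?E2) ?Y)"
      by (simp add: T_def)
    also have "\<dots> = (contraction M a b A \<otimes>\<^sub>m contraction M c d B) \<Zsemi> hzero L
      ((bang_ob M a A \<otimes>\<^sub>o bang_ob M b A) \<otimes>\<^sub>o (bang_ob M c B \<otimes>\<^sub>o bang_ob M d B)) ?Y"
      by (subst comp_zero) (auto simp: Hom_iff sms tensor_ob_assoc)
    also have "\<dots> = ?zero"
      using J by (subst comp_zero) (auto simp: Hom_iff sms J_def)
    finally show ?thesis .
  qed
  have "?lhs = ?x \<Zsemi> ((cocontraction M r s C \<Zsemi> contraction M t u C) \<Zsemi> ?y)"
    by (simp add: comp_assoc_Arr sms rs)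
  also have "\<dots> = ?x \<Zsemi> (hsum L ?R ?Y (\<lambda>j. F j \<Zsemi> ?y) J)"
    unfolding cc using fin F y XY by (subst hsum_comp) auto
  also have "\<dots> = hsum L ?X ?Y (\<lambda>j. ?x \<Zsemi> (F j \<Zsemi> ?y)) J"
    using fin XY x by (subst comp_hsum) (auto intro: comp_hom[OF F y])
  also have "\<dots> = hsum L ?X ?Y T J"
    \<comment> \<open>That \<open>T j\<close> lies in the hom set is obtained by reading
      \<open>eq\<close> from right to left, since the left-hand side is a composite of typed
      arrows.\<close>
    by (rule hsum_cong[OF XY(1,2)]) (auto simp: eq simp flip: eq intro: comp_hom[OF x comp_hom[OF F y]])
  also have "\<dots> = (if (r, s) = (t, u) then ?diag else ?zero)"
  proof (cases "(r, s) = (t, u)")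
    case True
    have T: "T (r, 0, 0, s) = ?diag"
      using bimonoid_diagonal_term[of "bang_arr M r (f \<Zsemi> h)" r A A' "bang_arr M s (g \<Zsemi> k)" s B B']
      by (simp add: T_def fk gh bang_zero Hom_iff sms)
    have "hsum L ?X ?Y T J = T (r, 0, 0, s)"
    proof (rule hsum_single[OF fin])
      show "(r, 0, 0, s) \<in> J" using True by (simp add: J_def)
      show "T (r, 0, 0, s) \<in> Hom L ?X ?Y"
        unfolding T using True by (auto simp: Hom_iff sms)
      \<comment> \<open>If \<open>b = c = 0\<close>, the equations defining \<open>J\<close> give
        \<open>a = r\<close> and \<open>d = s\<close>. Every other index therefore has a nonzero
        crossing grade, and \<open>vanish\<close> applies.\<close>
      show "T j = ?zero" if "j \<in> J" "j \<noteq> (r, 0, 0, s)" for j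
        using that vanish by (cases j) (fastforce simp: J_def)
    qed
    then show ?thesis using True T by simp
  next
    case False
    have "hsum L ?X ?Y T J = ?zero"
    proof (rule hsum_zero[OF XY(1,2) fin])
      show "T j = ?zero" if "j \<in> J" for j
        using that vanish False by (cases j) (fastforce simp: J_def)
    qed
    then show ?thesis using False by auto
  qed
  finally show ?thesis .
qed

end

section \<open>The Seely isomorphisms\<close>

locale graded_seely = graded_additive_bialgebra_modality L M
  for L :: "('o, 'm, 'z) additive_smc_scheme" (structure)
    and M :: "('r :: fas_semiring, 'o, 'm, 'y) bialgebra_modality_scheme" +
  fixes P :: "(nat, 'o, 'm) biproducts" and Q :: "('r \<times> 'r, 'o, 'm) biproducts"
  assumes P: "has_finite_biproducts L P" and Q: "has_finite_biproducts L Q"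
begin

section \<open>Components of the Seely map and of its inverse\<close>

definition seely_proj :: "'o \<Rightarrow> 'o \<Rightarrow> 'r \<times> 'r \<Rightarrow> 'm" where
  "seely_proj A B = (\<lambda>(s, t). contraction M s t (bsum2 P A B) \<Zsemi>
     (bang_arr M s (bproj2 P A B 0) \<otimes>\<^sub>m bang_arr M t (bproj2 P A B 1)))"

definition seely_inj :: "'o \<Rightarrow> 'o \<Rightarrow> 'r \<times> 'r \<Rightarrow> 'm" where
  "seely_inj A B = (\<lambda>(s, t). (bang_arr M s (binj2 P A B 0) \<otimes>\<^sub>m bang_arr M t (binj2 P A B 1)) \<Zsemi>
     cocontraction M s t (bsum2 P A B))"

context
  fixes A B
  assumes A: "A \<in> Obj L" and B: "B \<in> Obj L"
begin

lemmas biproduct2_arrows = biproduct2_Hom[OF P A B, unfolded Hom_iff]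

lemma seely_family_Obj: "seely_family L M A B j \<in> Obj L"
  by (cases j) (simp add: seely_family_def mod_simps A B)

lemma seely_biproduct:
  "biproduct L (splits r) (seely_family L M A B) (seely_ob L M Q r A B)
    (bproj Q (splits r) (seely_family L M A B)) (binj Q (splits r) (seely_family L M A B))"
  unfolding seely_ob_def by (rule finite_biproduct[OF Q finite_split_pairs seely_family_Obj])

lemma seely_ob_Obj: "seely_ob L M Q r A B \<in> Obj L"
  using seely_biproduct by (simp add: biproduct_def)

lemma seely_proj_Hom:
  "j \<in> splits r \<Longrightarrow> seely_proj A B j \<in> Hom L (bang_ob M r (bsum2 P A B)) (seely_family L M A B j)"
  by (auto simp: splits_def seely_family_def seely_proj_def Hom_iff mod_simps biproduct2_arrows)

lemma seely_inj_Hom: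
  "j \<in> splits r \<Longrightarrow> seely_inj A B j \<in> Hom L (seely_family L M A B j) (bang_ob M r (bsum2 P A B))"
  by (auto simp: splits_def seely_family_def seely_inj_def Hom_iff mod_simps biproduct2_arrows)

lemma chi_tensor_eq:
  "chi_tensor L M P Q r A B = hsum L (bang_ob M r (bsum2 P A B)) (seely_ob L M Q r A B)
    (\<lambda>j. seely_proj A B j \<Zsemi> binj Q (splits r) (seely_family L M A B) j) (splits r)"
  unfolding chi_tensor_def by (rule arg_cong2[of _ _ _ _ "hsum L _ _"]) (auto simp: seely_proj_def)

text \<open>The definition brackets each summand to the left, while the component form keeps
  \<open>seely_inj\<close> together on the right; hence associativity and typing are needed for each
  summand. For \<open>chi_tensor\<close> the two bracketings agree already.\<close>

lemma chi_tensor_inv_eq: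
  "chi_tensor_inv L M P Q r A B = hsum L (seely_ob L M Q r A B) (bang_ob M r (bsum2 P A B))
    (\<lambda>j. bproj Q (splits r) (seely_family L M A B) j \<Zsemi> seely_inj A B j) (splits r)"
  unfolding chi_tensor_inv_def
proof (rule hsum_cong)
  note b = biproduct_Hom[OF seely_biproduct]
  show "bproj Q (splits r) (seely_family L M A B) j \<Zsemi> seely_inj A B j
      \<in> Hom L (seely_ob L M Q r A B) (bang_ob M r (bsum2 P A B))" if "j \<in> splits r" for j
    using comp_hom[OF b(1) seely_inj_Hom] that by blast
  show "(case j of (s, t) \<Rightarrow> bproj Q (splits r) (seely_family L M A B) (s, t) \<Zsemi>
          (bang_arr M s (binj2 P A B 0) \<otimes>\<^sub>m bang_arr M t (binj2 P A B 1)) \<Zsemi>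
          cocontraction M s t (bsum2 P A B)) =
      bproj Q (splits r) (seely_family L M A B) j \<Zsemi> seely_inj A B j" if "j \<in> splits r" for j
    using b(1)[OF that]
    by (cases j) (simp add: seely_inj_def seely_family_def Hom_iff comp_assoc_Arr mod_simps biproduct2_arrows)
qed (simp_all add: seely_ob_Obj mod_simps biproduct2_arrows)

lemma chi_tensor_Hom:
  "chi_tensor L M P Q r A B \<in> Hom L (bang_ob M r (bsum2 P A B)) (seely_ob L M Q r A B)"
  unfolding chi_tensor_eq
  by (rule hsum_Hom)
    (auto simp: seely_ob_Obj mod_simps biproduct2_arrows
      intro: comp_hom[OF seely_proj_Hom biproduct_Hom(2)[OF seely_biproduct]])

lemma chi_tensor_inv_Hom:
  "chi_tensor_inv L M P Q r A B \<in> Hom L (seely_ob L M Q r A B) (bang_ob M r (bsum2 P A B))"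
  unfolding chi_tensor_inv_eq
  by (rule hsum_Hom)
    (auto simp: seely_ob_Obj mod_simps biproduct2_arrows
      intro: comp_hom[OF biproduct_Hom(1)[OF seely_biproduct] seely_inj_Hom])

lemma chi_tensor_proj:
  "j \<in> splits r \<Longrightarrow>
    chi_tensor L M P Q r A B \<Zsemi> bproj Q (splits r) (seely_family L M A B) j = seely_proj A B j"
  unfolding chi_tensor_eq
  by (rule biproduct_pair_proj[OF seely_biproduct finite_split_pairs])
    (auto intro: seely_proj_Hom)

lemma inj_chi_tensor_inv:
  "j \<in> splits r \<Longrightarrow>
    binj Q (splits r) (seely_family L M A B) j \<Zsemi> chi_tensor_inv L M P Q r A B = seely_inj A B j"
  unfolding chi_tensor_inv_eq
  by (rule biproduct_inj_copair[OF seely_biproduct finite_split_pairs])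
    (auto intro: seely_inj_Hom)

text \<open>Together with \<open>seely_proj_inj_sum\<close> this says that \<open>!_r\<close> of the
  binary biproduct is itself a biproduct of the family \<open>seely_family L M A B\<close>, with
  \<open>seely_proj\<close> and \<open>seely_inj\<close> as its projections and injections.\<close>

lemma seely_inj_proj:
  assumes "i \<in> splits r" "j \<in> splits r"
  shows "seely_inj A B i \<Zsemi> seely_proj A B j =
    (if i = j then Ide L (seely_family L M A B i)
     else hzero L (seely_family L M A B i) (seely_family L M A B j))"
proof -
  obtain s t s' t' where ij: "i = (s, t)" "j = (s', t')" by fastforce
  with assms have "s + t = s' + t'" by (simp add: splits_def)
  \<comment> \<open>Here \<open>f\<close> and \<open>g\<close> are the two binary injections,
    \<open>h\<close> and \<open>k\<close> the two projections. The mixed composites are zero, and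
    \<open>f \<Zsemi> h\<close> and \<open>g \<Zsemi> k\<close> are identities.\<close>
  from cocontraction_contraction_orthogonal[OF biproduct2_Hom(3,4,1,2)[OF P A B]
      biproduct2_inj_proj(3,4)[OF P A B] this]
  show ?thesis
    by (simp add: ij seely_inj_def seely_proj_def seely_family_def biproduct2_inj_proj[OF P A B]
        mod_simps A B)
qed

text \<open>Apply \<open>!_r\<close> to the binary decomposition of the identity. The additivity law
  gives a sum over the splittings of \<open>r\<close>, and functoriality factors the middle of each
  summand through the two summands of the biproduct.\<close>

lemma seely_proj_inj_sum:
  "hsum L (bang_ob M r (bsum2 P A B)) (bang_ob M r (bsum2 P A B))
    (\<lambda>j. seely_proj A B j \<Zsemi> seely_inj A B j) (splits r) = Ide L (bang_ob M r (bsum2 P A B))"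
proof -
  let ?S = "bsum2 P A B"
  let ?f = "bproj2 P A B 0 \<Zsemi> binj2 P A B 0" and ?g = "bproj2 P A B 1 \<Zsemi> binj2 P A B 1"
  have fg: "?f \<in> Hom L ?S ?S" "?g \<in> Hom L ?S ?S"
    by (auto simp: Hom_iff mod_simps biproduct2_arrows)
  have "Ide L (bang_ob M r ?S) = bang_arr M r (?f +\<^sub>m ?g)"
    using biproduct2_arrows by (simp add: biproduct2_sum[OF P A B] bang_Ide)
  also have "\<dots> = hsum L (bang_ob M r ?S) (bang_ob M r ?S)
    (\<lambda>j. seely_proj A B j \<Zsemi> seely_inj A B j) (splits r)"
    unfolding bang_add[OF fg]
  proof (rule hsum_cong)
    show "seely_proj A B j \<Zsemi> seely_inj A B j \<in> Hom L (bang_ob M r ?S) (bang_ob M r ?S)"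
      if "j \<in> splits r" for j
      using comp_hom[OF seely_proj_Hom seely_inj_Hom] that by blast
    show "(case j of (s, t) \<Rightarrow> contraction M s t ?S \<Zsemi> (bang_arr M s ?f \<otimes>\<^sub>m bang_arr M t ?g) \<Zsemi>
        cocontraction M s t ?S) = seely_proj A B j \<Zsemi> seely_inj A B j" for j
    proof (cases j)
      case (Pair s t)
      have "bang_arr M s ?f \<otimes>\<^sub>m bang_arr M t ?g =
        (bang_arr M s (bproj2 P A B 0) \<otimes>\<^sub>m bang_arr M t (bproj2 P A B 1)) \<Zsemi>
        (bang_arr M s (binj2 P A B 0) \<otimes>\<^sub>m bang_arr M t (binj2 P A B 1))"
        by (simp add: interchange bang_comp mod_simps biproduct2_arrows)
      then show ?thesis
        by (simp add: Pair seely_proj_def seely_inj_def comp_assoc_Arr mod_simps biproduct2_arrows)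
    qed
  qed (simp_all add: mod_simps biproduct2_arrows)
  finally show ?thesis by simp
qed

lemma chi_tensor_inverse:
  "inverse_arrows L (bang_ob M r (bsum2 P A B)) (seely_ob L M Q r A B)
    (chi_tensor L M P Q r A B) (chi_tensor_inv L M P Q r A B)"
proof -
  let ?S = "bang_ob M r (bsum2 P A B)" and ?T = "seely_ob L M Q r A B"
  let ?X = "seely_family L M A B"
  let ?p = "bproj Q (splits r) ?X" and ?i = "binj Q (splits r) ?X"
  let ?chi = "chi_tensor L M P Q r A B" and ?inv = "chi_tensor_inv L M P Q r A B"
  note b = biproduct_Hom[OF seely_biproduct]
  have S: "?S \<in> Obj L" by (simp add: mod_simps biproduct2_arrows)
  have pj: "?p j \<Zsemi> seely_inj A B j \<in> Hom L ?T ?S" if "j \<in> splits r" for j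
    using comp_hom[OF b(1) seely_inj_Hom] that by blast
  have "?chi \<Zsemi> ?inv = hsum L ?S ?S (\<lambda>j. ?chi \<Zsemi> (?p j \<Zsemi> seely_inj A B j)) (splits r)"
    unfolding chi_tensor_inv_eq by (rule comp_hsum[OF finite_split_pairs S chi_tensor_Hom pj])
  also have "\<dots> = hsum L ?S ?S (\<lambda>j. seely_proj A B j \<Zsemi> seely_inj A B j) (splits r)"
  proof (rule hsum_cong[OF S S])
    show "seely_proj A B j \<Zsemi> seely_inj A B j \<in> Hom L ?S ?S" if "j \<in> splits r" for j
      using comp_hom[OF seely_proj_Hom seely_inj_Hom] that by blast
    show "?chi \<Zsemi> (?p j \<Zsemi> seely_inj A B j) = seely_proj A B j \<Zsemi> seely_inj A B j"
      if "j \<in> splits r" for j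
      using comp_assoc[OF chi_tensor_Hom b(1) seely_inj_Hom] chi_tensor_proj that by metis
  qed
  finally have 1: "?chi \<Zsemi> ?inv = Ide L ?S" by (simp add: seely_proj_inj_sum)
  have IC: "?inv \<Zsemi> ?chi \<in> Hom L ?T ?T"
    by (rule comp_hom[OF chi_tensor_inv_Hom chi_tensor_Hom])
  have "?inv \<Zsemi> ?chi = Ide L ?T"
  \<comment> \<open>Equality of endomorphisms of a biproduct is tested entry by entry: precompose
    with the injection at \<open>i\<close>, then postcompose with the projection at
    \<open>j\<close>.\<close>
  proof (rule biproduct_inj_eqI[OF seely_biproduct finite_split_pairs IC ide_hom[OF seely_ob_Obj]])
    fix i assume i: "i \<in> splits r"
    show "?i i \<Zsemi> (?inv \<Zsemi> ?chi) = ?i i \<Zsemi> Ide L ?T"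
    proof (rule biproduct_proj_eqI[OF seely_biproduct finite_split_pairs comp_hom[OF b(2)[OF i] IC]
          comp_hom[OF b(2)[OF i] ide_hom[OF seely_ob_Obj]]])
      fix j assume j: "j \<in> splits r"
      have "(?i i \<Zsemi> (?inv \<Zsemi> ?chi)) \<Zsemi> ?p j = (?i i \<Zsemi> ?inv) \<Zsemi> (?chi \<Zsemi> ?p j)"
        using b(1)[OF j] b(2)[OF i] chi_tensor_Hom chi_tensor_inv_Hom
        by (simp add: Hom_iff comp_Arr comp_assoc_Arr)
      \<comment> \<open>Both sides are the same Kronecker delta: the left by
        \<open>seely_inj_proj\<close>, the right by the equations of the biproduct over
        \<open>splits r\<close>.\<close>
      also have "\<dots> = ?i i \<Zsemi> ?p j"
        using seely_inj_proj[OF i j] seely_biproduct i j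
        by (simp add: inj_chi_tensor_inv chi_tensor_proj biproduct_def)
      finally show "(?i i \<Zsemi> (?inv \<Zsemi> ?chi)) \<Zsemi> ?p j = (?i i \<Zsemi> Ide L ?T) \<Zsemi> ?p j"
        using comp_ide[OF b(2)[OF i]] by simp
    qed
  qed
  with 1 show ?thesis
    by (simp add: inverse_arrows_def chi_tensor_Hom chi_tensor_inv_Hom)
qed

end

section \<open>Functoriality and naturality in both arguments\<close>

lemma seely_family_arr_Hom:
  assumes "f \<in> Hom L A A'" "g \<in> Hom L B B'"
  shows "(case j of (s, t) \<Rightarrow> bang_arr M s f \<otimes>\<^sub>m bang_arr M t g)
    \<in> Hom L (seely_family L M A B j) (seely_family L M A' B' j)"
  using assms by (cases j) (simp add: seely_family_def Hom_iff mod_simps)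

lemma bang_bsum2_functor:
  "is_functor (prod_category L L) L
    (\<lambda>(A, B). bang_ob M r (bsum2 P A B)) (\<lambda>(f, g). bang_arr M r (bmap2 L P f g))"
proof -
  have "bang_arr M r (bmap2 L P f g) \<in>
      Hom L (bang_ob M r (bsum2 P A B)) (bang_ob M r (bsum2 P A' B'))"
    if "f \<in> Hom L A A'" "g \<in> Hom L B B'" for f g A A' B B'
    using bmap2_Hom[OF P that] by (simp add: Hom_iff bang_Arr)
  moreover have "bang_arr M r (bmap2 L P (f \<Zsemi> f') (g \<Zsemi> g')) =
      bang_arr M r (bmap2 L P f g) \<Zsemi> bang_arr M r (bmap2 L P f' g')"
    if "f \<in> Hom L A B" "f' \<in> Hom L B C" "g \<in> Hom L A' B'" "g' \<in> Hom L B' C'"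
    for f f' g g' A B C A' B' C'
    using bmap2_Hom[OF P that(1,3)] bmap2_Hom[OF P that(2,4)]
    by (simp add: bmap2_comp[OF P that] Hom_iff bang_comp)
  ultimately show ?thesis
    using biproduct2_Hom(5)[OF P]
    by (auto simp: is_functor_def prod_category_def Hom_def bang_Obj bmap2_Ide[OF P] bang_Ide)
qed

lemma seely_arr_Hom:
  assumes "f \<in> Hom L A A'" "g \<in> Hom L B B'"
  shows "seely_arr L M Q r f g \<in> Hom L (seely_ob L M Q r A B) (seely_ob L M Q r A' B')"
  using bmap_Hom[OF Q finite_split_pairs seely_family_arr_Hom[OF assms]] assms
  by (simp add: seely_arr_def seely_ob_def Hom_iff)

lemma seely_functor:
  "is_functor (prod_category L L) L
    (\<lambda>(A, B). seely_ob L M Q r A B) (\<lambda>(f, g). seely_arr L M Q r f g)"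
proof -
  have "seely_arr L M Q r (f \<Zsemi> f') (g \<Zsemi> g') = seely_arr L M Q r f g \<Zsemi> seely_arr L M Q r f' g'"
    if a: "f \<in> Hom L A B" "f' \<in> Hom L B C" "g \<in> Hom L A' B'" "g' \<in> Hom L B' C'"
    for f f' g g' A B C A' B' C'
  proof -
    have d: "Dom L f = A" "Dom L g = A'" "Cod L f = B" "Cod L g = B'"
      "Dom L f' = B" "Dom L g' = B'" "Cod L f' = C" "Cod L g' = C'"
      "Dom L (f \<Zsemi> f') = A" "Cod L (f \<Zsemi> f') = C" "Dom L (g \<Zsemi> g') = A'" "Cod L (g \<Zsemi> g') = C'"
      using a by (auto simp: Hom_iff comp_Arr)
    show ?thesis unfolding seely_arr_def d
    proof (rule bmap_comp[OF Q finite_split_pairs seely_family_arr_Hom[OF a(1,3)]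
          seely_family_arr_Hom[OF a(2,4)]])
      show "(case j of (s, t) \<Rightarrow> bang_arr M s (f \<Zsemi> f') \<otimes>\<^sub>m bang_arr M t (g \<Zsemi> g')) =
          (case j of (s, t) \<Rightarrow> bang_arr M s f \<otimes>\<^sub>m bang_arr M t g) \<Zsemi>
          (case j of (s, t) \<Rightarrow> bang_arr M s f' \<otimes>\<^sub>m bang_arr M t g')" for j
        using a by (cases j) (simp add: Hom_iff interchange bang_comp mod_simps)
    qed
  qed
  moreover have "seely_arr L M Q r (Ide L A) (Ide L B) = Ide L (seely_ob L M Q r A B)"
    if "A \<in> Obj L" "B \<in> Obj L" for A B
    unfolding seely_arr_def seely_ob_def Ide_Arr[OF that(1)] Ide_Arr[OF that(2)]
    by (rule bmap_Ide[OF Q finite_split_pairs])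
      (use that in \<open>auto simp: seely_family_Obj seely_family_def mod_simps\<close>)
  ultimately show ?thesis
    using seely_arr_Hom
    by (auto simp: is_functor_def prod_category_def Hom_def seely_ob_Obj)
qed

text \<open>Testing against the projections of the target leaves a statement about
  \<open>seely_proj\<close>. It follows from naturality of contraction at
  \<open>bmap2 L P f g\<close> and the projection equations of \<open>bmap2\<close>.\<close>

lemma chi_tensor_naturality:
  assumes f: "f \<in> Hom L A A'" and g: "g \<in> Hom L B B'"
  shows "bang_arr M r (bmap2 L P f g) \<Zsemi> chi_tensor L M P Q r A' B' =
    chi_tensor L M P Q r A B \<Zsemi> seely_arr L M Q r f g"
proof -
  note o = Hom_Obj(1)[OF f] Hom_Obj(1)[OF g] and o' = Hom_Obj(2)[OF f] Hom_Obj(2)[OF g]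
  note bm = bmap2_Hom[OF P f g, unfolded Hom_iff]
  note arr = f[unfolded Hom_iff] g[unfolded Hom_iff]
  note h = biproduct2_arrows[OF o] and h' = biproduct2_arrows[OF o']
  have bang: "bang_arr M r (bmap2 L P f g) \<in>
      Hom L (bang_ob M r (bsum2 P A B)) (bang_ob M r (bsum2 P A' B'))"
    using bm by (simp add: Hom_iff bang_Arr)
  show ?thesis
  proof (rule biproduct_proj_eqI[OF seely_biproduct[OF o'] finite_split_pairs
        comp_hom[OF bang chi_tensor_Hom[OF o']]
        comp_hom[OF chi_tensor_Hom[OF o] seely_arr_Hom[OF f g]]])
    fix j assume j: "j \<in> splits r"
    obtain s t where st: "j = (s, t)" "s + t = r"
      using j by (auto simp: splits_def)
    let ?p = "bproj Q (splits r) (seely_family L M A B) j"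
    let ?p' = "bproj Q (splits r) (seely_family L M A' B') j"
    let ?fg = "bang_arr M s f \<otimes>\<^sub>m bang_arr M t g"
    have p: "?p \<in> Hom L (seely_ob L M Q r A B) (seely_family L M A B j)"
      and p': "?p' \<in> Hom L (seely_ob L M Q r A' B') (seely_family L M A' B' j)"
      using biproduct_Hom(1)[OF seely_biproduct] o o' j by auto
    have fg: "?fg \<in> Hom L (seely_family L M A B j) (seely_family L M A' B' j)"
      using seely_family_arr_Hom[OF f g, of j] st by simp
    have "(bang_arr M r (bmap2 L P f g) \<Zsemi> chi_tensor L M P Q r A' B') \<Zsemi> ?p' =
        bang_arr M r (bmap2 L P f g) \<Zsemi> seely_proj A' B' j"
      using comp_assoc[OF bang chi_tensor_Hom[OF o'] p'] chi_tensor_proj[OF o' j] by simp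
    \<comment> \<open>The grade \<open>r\<close> is written as \<open>s + t\<close> so that
      naturality of contraction matches.\<close>
    also have "\<dots> = (bang_arr M (s + t) (bmap2 L P f g) \<Zsemi> contraction M s t (bsum2 P A' B')) \<Zsemi>
        (bang_arr M s (bproj2 P A' B' 0) \<otimes>\<^sub>m bang_arr M t (bproj2 P A' B' 1))"
      using bm h' by (simp add: st seely_proj_def comp_assoc_Arr mod_simps)
    also have "\<dots> = contraction M s t (bsum2 P A B) \<Zsemi>
        ((bang_arr M s (bmap2 L P f g) \<otimes>\<^sub>m bang_arr M t (bmap2 L P f g)) \<Zsemi>
        (bang_arr M s (bproj2 P A' B' 0) \<otimes>\<^sub>m bang_arr M t (bproj2 P A' B' 1)))"
      using bm h' h contraction_naturality[of "bmap2 L P f g" s t]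
      by (simp add: comp_assoc_Arr mod_simps)
    also have "\<dots> = seely_proj A B j \<Zsemi> ?fg"
      using bm h h' arr bmap2_proj[OF P f g]
      by (simp add: st seely_proj_def comp_assoc_Arr interchange bang_comp mod_simps)
    also have "\<dots> = chi_tensor L M P Q r A B \<Zsemi> (?p \<Zsemi> ?fg)"
      using comp_assoc[OF chi_tensor_Hom[OF o] p fg] chi_tensor_proj[OF o j] by simp
    also have "?p \<Zsemi> ?fg = seely_arr L M Q r f g \<Zsemi> ?p'"
      using bmap_proj[OF Q finite_split_pairs seely_family_arr_Hom[OF f g] j] arr
      by (simp add: seely_arr_def st)
    also have "chi_tensor L M P Q r A B \<Zsemi> (seely_arr L M Q r f g \<Zsemi> ?p') =
        (chi_tensor L M P Q r A B \<Zsemi> seely_arr L M Q r f g) \<Zsemi> ?p'"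
      using comp_assoc[OF chi_tensor_Hom[OF o] seely_arr_Hom[OF f g] p'] by simp
    finally show "(bang_arr M r (bmap2 L P f g) \<Zsemi> chi_tensor L M P Q r A' B') \<Zsemi> ?p' =
        (chi_tensor L M P Q r A B \<Zsemi> seely_arr L M Q r f g) \<Zsemi> ?p'" .
  qed
qed

lemma chi_tensor_natural_isomorphism:
  "natural_isomorphism (prod_category L L) L
    (\<lambda>(A, B). bang_ob M r (bsum2 P A B)) (\<lambda>(f, g). bang_arr M r (bmap2 L P f g))
    (\<lambda>(A, B). seely_ob L M Q r A B) (\<lambda>(f, g). seely_arr L M Q r f g)
    (\<lambda>(A, B). chi_tensor L M P Q r A B)"
proof -
  \<comment> \<open>Phrased with \<open>Dom\<close> and \<open>Cod\<close>, the form left after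
    unfolding hom sets of the product category.\<close>
  have "bang_arr M r (bmap2 L P f g) \<Zsemi> chi_tensor L M P Q r (Cod L f) (Cod L g) =
      chi_tensor L M P Q r (Dom L f) (Dom L g) \<Zsemi> seely_arr L M Q r f g"
    if "f \<in> Arr L" "g \<in> Arr L" for f g
    using chi_tensor_naturality that by (simp add: Hom_iff)
  moreover have "isomorphism L (bang_ob M r (bsum2 P A B)) (seely_ob L M Q r A B)
      (chi_tensor L M P Q r A B)" if "A \<in> Obj L" "B \<in> Obj L" for A B
    using chi_tensor_inverse[OF that] by (auto simp: isomorphism_def)
  ultimately show ?thesis
    using bang_bsum2_functor seely_functor chi_tensor_Hom
    by (auto simp: natural_isomorphism_def natural_transformation_def prod_category_def Hom_def)
qed

end

section \<open>The unit isomorphism\<close>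

lemma (in graded_additive_bialgebra_modality) chi_unit_inverse:
  assumes "zero_object L Z"
  shows "inverse_arrows L (bang_ob M 0 Z) \<I> (chi_unit M Z) (chi_unit_inv M Z)"
proof -
  have Z: "Z \<in> Obj L" using assms by (simp add: zero_object_def)
  \<comment> \<open>Both are endomorphisms of a zero object, which has only one.\<close>
  then have "Ide L Z = hzero L Z Z"
    using assms ide_hom[OF Z] hzero_Hom[OF Z Z] by (auto simp: zero_object_def)
  then have "weakening M Z \<Zsemi> coweakening M Z = Ide L (bang_ob M 0 Z)"
    using bang_zero[OF Z Z, of 0] bang_Ide[OF Z, of 0] by simp
  \<comment> \<open>The composite in the other order is the axiom
    \<open>coweakening_weakening\<close>.\<close>
  then show ?thesis
    using Z by (simp add: inverse_arrows_def chi_unit_def chi_unit_inv_def Hom_iff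
        weakening_Arr coweakening_Arr coweakening_weakening)
qed

theorem theorem4p5:
  fixes L :: "('o, 'm) additive_smc"
    and M :: "('r :: fas_semiring, 'o, 'm) bialgebra_modality"
    and P :: "(nat, 'o, 'm) biproducts"
    and Q :: "('r \<times> 'r, 'o, 'm) biproducts"
    and Z :: 'o
  assumes "additive_symmetric_monoidal_category L"
    and "has_finite_biproducts L P"
    and "has_finite_biproducts L Q"
    and "zero_object L Z"
    and "graded_additive_bialgebra_modality L M"
  shows "(\<forall>r. natural_isomorphism (prod_category L L) L
            (\<lambda>(A, B). bang_ob M r (bsum2 P A B)) (\<lambda>(f, g). bang_arr M r (bmap2 L P f g))
            (\<lambda>(A, B). seely_ob L M Q r A B) (\<lambda>(f, g). seely_arr L M Q r f g)
            (\<lambda>(A, B). chi_tensor L M P Q r A B)) \<and>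
    (\<forall>r. \<forall>A\<in>Obj L. \<forall>B\<in>Obj L.
       inverse_arrows L (bang_ob M r (bsum2 P A B)) (seely_ob L M Q r A B)
         (chi_tensor L M P Q r A B) (chi_tensor_inv L M P Q r A B)) \<and>
    isomorphism L (bang_ob M 0 Z) (tensor_unit L) (chi_unit M Z) \<and>
    inverse_arrows L (bang_ob M 0 Z) (tensor_unit L) (chi_unit M Z) (chi_unit_inv M Z) \<and>
    (\<forall>r. \<forall>A\<in>Obj L. \<forall>B\<in>Obj L.
       isomorphic L (bang_ob M r (bsum2 P A B)) (seely_ob L M Q r A B)) \<and>
    isomorphic L (bang_ob M 0 Z) (tensor_unit L)"
proof -
  interpret graded_seely L M P Q
    using assms by (simp add: graded_seely_def graded_seely_axioms_def)
  show ?thesis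
    \<comment> \<open>The explicit inverses serve as witnesses for the remaining existential
      claims.\<close>
    using chi_tensor_natural_isomorphism chi_tensor_inverse chi_unit_inverse[OF assms(4)]
    unfolding isomorphic_def isomorphism_def by blast
qed

end
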